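(* Let $\mathcal{S}$ be a $C^2$-smooth surface of revolution which is strictly convex at an isolated umbilic point $p$ lying on the axis of rotational symmetry, with $\theta=0$ at $p$. Suppose that the umbilic slope $\mu_p$ of $\mathcal{S}$ at $p$ exists and $\mu_p\in\mathbb{R}$. (A) If the radii of curvature satisfy $\lim_{\theta\to 0}\left(\frac{r_2(\theta)-r_1(\theta)}{\sin^\alpha\theta}\right)=\gamma$ for some $\alpha\ge 0$ and $\gamma\in\mathbb{R}$, then $\mu_p\ge \alpha+1$, with equality if $\gamma\ne 0$. (B) Conversely, if $\alpha\ge 0$ and $\mu_p>\alpha+1$, then $\lim_{\theta\to 0}\left(\frac{r_2(\theta)-r_1(\theta)}{\sin^\alpha\theta}\right)=0$.
   Context: $\mathcal{S}\subset\mathbb{R}^3$ is a $C^2$-smooth regular oriented surface of revolution about the $z$-axis, fully revolved about it. $k_1$ and $k_2$ denote the principal curvatures along the parallels and along the profile curves respectively, $r_i=1/k_i$ are the radii of curvature, and $K=k_1k_2$ is the Gauss curvature. The Gauss angle $\theta$ is the angle between the oriented unit normal and the positive $z$-axis; near a point with $K\neq 0$ the profile curve $(\rho(\theta),h(\theta))$ in the $yz$-plane ($\rho$ the signed distance from the axis, $h$ the height), with unit normal $(\sin\theta,\cos\theta)$, is parametrised by $\theta$, and $r_1,r_2$ are regarded as functions of $\theta$, with sign convention $\rho=r_1\sin\theta$, $dh/d\theta=-r_2\sin\theta$; one has $r_i(-\theta)=r_i(\theta)$. Limits $\theta\to0$ are taken through positive $\theta$. $\mathcal{S}$ is strictly convex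 at $q$ if $K(q)>0$. An umbilic point is a point with $r_1=r_2$; it is isolated if some neighbourhood of it in $\mathcal{S}$ contains no other umbilic point. If $p$ is an umbilic with Gauss angle $\theta_0$ (here $\theta_0=0$) and $r_0$ is the common value of $r_1,r_2$ at $p$, the umbilic slope is $\mu_p=\lim_{\theta\to\theta_0}\frac{r_2(\theta)-r_0}{r_1(\theta)-r_0}$, when this limit exists. *)

theory Defs
  imports "HOL-Analysis.Analysis"
begin

section \<open>Regular oriented surfaces of class \<open>C\<^sup>2\<close>\<close>

definition C2_on :: "('a::real_normed_vector \<Rightarrow> 'b::real_normed_vector) \<Rightarrow> 'a set \<Rightarrow> bool" where
  "C2_on f U \<longleftrightarrow>
     (\<exists>(f' :: 'a \<Rightarrow> 'a \<Rightarrow>\<^sub>L 'b) (f'' :: 'a \<Rightarrow> 'a \<Rightarrow>\<^sub>L 'a \<Rightarrow>\<^sub>L 'b).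
        (\<forall>u\<in>U. (f has_derivative blinfun_apply (f' u)) (at u) \<and>
               (f' has_derivative blinfun_apply (f'' u)) (at u)) \<and>
        continuous_on U f'')"

definition C2_patch :: "(real^3) set \<Rightarrow> (real^2 \<Rightarrow> real^3) \<Rightarrow> (real^2) set \<Rightarrow> bool" where
  "C2_patch S X U \<longleftrightarrow>
     open U \<and> C2_on X U \<and> (\<forall>u\<in>U. inj (frechet_derivative X (at u))) \<and>
     openin (top_of_set S) (X ` U) \<and> (\<exists>Y. homeomorphism U (X ` U) X Y)"

definition C2_regular_surface :: "(real^3) set \<Rightarrow> bool" where
  "C2_regular_surface S \<longleftrightarrow> (\<forall>q\<in>S. \<exists>X U. C2_patch S X U \<and> q \<in> X ` U)"

definition tangent_space :: "(real^3) set \<Rightarrow> real^3 \<Rightarrow> (real^3) set" where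
  "tangent_space S q =
     {v. \<exists>c e. e > 0 \<and> (\<forall>t::real. \<bar>t\<bar> < e \<longrightarrow> c t \<in> S) \<and> c 0 = q \<and>
               (c has_vector_derivative v) (at 0)}"

text \<open>An orientation is a continuous field of unit normals. Only the values of \<open>N\<close> on \<open>S\<close> matter.\<close>

definition unit_normal_field :: "(real^3) set \<Rightarrow> (real^3 \<Rightarrow> real^3) \<Rightarrow> bool" where
  "unit_normal_field S N \<longleftrightarrow>
     continuous_on S N \<and>
     (\<forall>q\<in>S. norm (N q) = 1 \<and> (\<forall>v\<in>tangent_space S q. N q \<bullet> v = 0))"


section \<open>Surfaces of revolution\<close>

text \<open>Rotation about the \<open>z\<close>-axis. Coordinates 1, 2, 3 are \<open>x\<close>, \<open>y\<close>, \<open>z\<close>.\<close>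

definition rotz :: "real \<Rightarrow> real^3 \<Rightarrow> real^3" where
  "rotz \<phi> v = vector [cos \<phi> * v$1 - sin \<phi> * v$2, sin \<phi> * v$1 + cos \<phi> * v$2, v$3]"

definition C2_surface_of_revolution :: "(real^3) set \<Rightarrow> (real^3 \<Rightarrow> real^3) \<Rightarrow> bool" where
  "C2_surface_of_revolution S N \<longleftrightarrow>
     C2_regular_surface S \<and> unit_normal_field S N \<and> (\<forall>\<phi>. rotz \<phi> ` S = S)"

definition on_axis :: "real^3 \<Rightarrow> bool" where
  "on_axis q \<longleftrightarrow> q$1 = 0 \<and> q$2 = 0"

text \<open>The planes containing the \<open>z\<close>-axis; \<open>meridian_plane 0\<close> is the \<open>yz\<close>-plane.\<close>

definition meridian_plane :: "real \<Rightarrow> (real^3) set" where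
  "meridian_plane \<phi> = rotz \<phi> ` {v. v$1 = 0}"


section \<open>Principal curvatures\<close>

text \<open>
  \<open>k\<close> is the eigenvalue of the differential of the Gauss map for the tangent vector \<open>v\<close>. The
  derivative is taken within \<open>S\<close>, so \<open>A\<close> is determined on the tangent space only. The sign
  is that of \<open>dN\<close> (not \<open>-dN\<close>), so that a sphere with outward normal has positive
  curvatures; this is the convention \<open>\<rho> = r\<^sub>1 sin \<theta>\<close>, \<open>dh/d\<theta> = - r\<^sub>2 sin \<theta>\<close>
  for the unit normal \<open>(sin \<theta>, cos \<theta>)\<close>.
\<close>

definition principal_curvature ::
  "(real^3) set \<Rightarrow> (real^3 \<Rightarrow> real^3) \<Rightarrow> real^3 \<Rightarrow> real^3 \<Rightarrow> real \<Rightarrow> bool" where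
  "principal_curvature S N q v k \<longleftrightarrow>
     v \<in> tangent_space S q \<and> v \<noteq> 0 \<and>
     (\<exists>A. (N has_derivative A) (at q within S) \<and> A v = k *\<^sub>R v)"

text \<open>
  For a point of \<open>meridian_plane \<phi>\<close>, the parallel points in the direction normal to that plane,
  and the profile curve in a direction tangent to \<open>S\<close> within it. Off the axis the plane through
  \<open>q\<close> is unique. At a point of \<open>S\<close> on the axis every meridian plane is admitted, and all of
  them give the same curvature, because there \<open>dN\<close> commutes with rotations.
\<close>

definition k_parallel :: "(real^3) set \<Rightarrow> (real^3 \<Rightarrow> real^3) \<Rightarrow> real^3 \<Rightarrow> real" where
  "k_parallel S N q =
     (THE k. \<exists>\<phi>. q \<in> meridian_plane \<phi> \<and> principal_curvature S N q (rotz \<phi> (axis 1 1)) k)"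

definition k_profile :: "(real^3) set \<Rightarrow> (real^3 \<Rightarrow> real^3) \<Rightarrow> real^3 \<Rightarrow> real" where
  "k_profile S N q =
     (THE k. \<exists>\<phi>. q \<in> meridian_plane \<phi> \<and> (\<exists>v\<in>meridian_plane \<phi>. principal_curvature S N q v k))"

definition gauss_curvature :: "(real^3) set \<Rightarrow> (real^3 \<Rightarrow> real^3) \<Rightarrow> real^3 \<Rightarrow> real" where
  "gauss_curvature S N q = k_parallel S N q * k_profile S N q"

definition strictly_convex_at :: "(real^3) set \<Rightarrow> (real^3 \<Rightarrow> real^3) \<Rightarrow> real^3 \<Rightarrow> bool" where
  "strictly_convex_at S N q \<longleftrightarrow> gauss_curvature S N q > 0"

definition radius_parallel :: "(real^3) set \<Rightarrow> (real^3 \<Rightarrow> real^3) \<Rightarrow> real^3 \<Rightarrow> real" where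
  "radius_parallel S N q = 1 / k_parallel S N q"

definition radius_profile :: "(real^3) set \<Rightarrow> (real^3 \<Rightarrow> real^3) \<Rightarrow> real^3 \<Rightarrow> real" where
  "radius_profile S N q = 1 / k_profile S N q"

definition umbilic :: "(real^3) set \<Rightarrow> (real^3 \<Rightarrow> real^3) \<Rightarrow> real^3 \<Rightarrow> bool" where
  "umbilic S N q \<longleftrightarrow> q \<in> S \<and> radius_parallel S N q = radius_profile S N q"

definition isolated_umbilic :: "(real^3) set \<Rightarrow> (real^3 \<Rightarrow> real^3) \<Rightarrow> real^3 \<Rightarrow> bool" where
  "isolated_umbilic S N p \<longleftrightarrow>
     umbilic S N p \<and>
     (\<exists>T. openin (top_of_set S) T \<and> p \<in> T \<and> (\<forall>q\<in>T. umbilic S N q \<longrightarrow> q = p))"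


section \<open>The Gauss angle and the umbilic slope\<close>

text \<open>The signed angle between the normal and the positive \<open>z\<close>-axis, for points of the
  \<open>yz\<close>-plane, where the normal is \<open>(sin \<theta>, cos \<theta>)\<close>.\<close>

definition has_gauss_angle :: "(real^3 \<Rightarrow> real^3) \<Rightarrow> real^3 \<Rightarrow> real \<Rightarrow> bool" where
  "has_gauss_angle N q \<theta> \<longleftrightarrow> q \<in> meridian_plane 0 \<and> N q = vector [0, sin \<theta>, cos \<theta>]"

definition is_gauss_param ::
  "(real^3) set \<Rightarrow> (real^3 \<Rightarrow> real^3) \<Rightarrow> real^3 \<Rightarrow> (real \<Rightarrow> real^3) \<Rightarrow> bool" where
  "is_gauss_param S N p c \<longleftrightarrow>
     c 0 = p \<and>
     (\<exists>e>0. continuous_on {-e<..<e} c \<and>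
            (\<forall>\<theta>\<in>{-e<..<e}. c \<theta> \<in> S \<and> has_gauss_angle N (c \<theta>) \<theta>))"

text \<open>
  The profile curve through \<open>p\<close> (with Gauss angle 0 at \<open>p\<close>) parametrised by the Gauss angle.
  If the Gauss curvature at \<open>p\<close> is nonzero, such a parametrisation exists and is unique
  near \<open>\<theta> = 0\<close>, so the limits below do not depend on the choice.
\<close>

definition gauss_param :: "(real^3) set \<Rightarrow> (real^3 \<Rightarrow> real^3) \<Rightarrow> real^3 \<Rightarrow> real \<Rightarrow> real^3" where
  "gauss_param S N p = (SOME c. is_gauss_param S N p c)"

definition r1 :: "(real^3) set \<Rightarrow> (real^3 \<Rightarrow> real^3) \<Rightarrow> real^3 \<Rightarrow> real \<Rightarrow> real" where
  "r1 S N p \<theta> = radius_parallel S N (gauss_param S N p \<theta>)"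

definition r2 :: "(real^3) set \<Rightarrow> (real^3 \<Rightarrow> real^3) \<Rightarrow> real^3 \<Rightarrow> real \<Rightarrow> real" where
  "r2 S N p \<theta> = radius_profile S N (gauss_param S N p \<theta>)"

text \<open>The umbilic slope at an umbilic \<open>p\<close> with Gauss angle 0 exists and equals \<open>\<mu>\<close>; here
  \<open>radius_parallel S N p\<close> is the common value \<open>r\<^sub>0\<close> of the two radii at \<open>p\<close>.\<close>

definition has_umbilic_slope ::
  "(real^3) set \<Rightarrow> (real^3 \<Rightarrow> real^3) \<Rightarrow> real^3 \<Rightarrow> real \<Rightarrow> bool" where
  "has_umbilic_slope S N p \<mu> \<longleftrightarrow>
     ((\<lambda>\<theta>. (r2 S N p \<theta> - radius_parallel S N p) / (r1 S N p \<theta> - radius_parallel S N p))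
        \<longlongrightarrow> \<mu>) (at_right 0)"

end

theory Submission
  imports Defs
begin

text \<open>
  Near \<open>p\<close> the surface is a graph over its horizontal tangent plane. Along the profile curve
  \<open>\<sigma> t = (0, t, h t)\<close> write the normal as \<open>N (\<sigma> t) = (0, a t, b t)\<close> with \<open>b > 0\<close>; since the normal
  field commutes with rotations, the principal curvatures there are \<open>a t / t\<close> and \<open>a' t\<close>. As
  \<open>a' 0 \<noteq> 0\<close>, the curve can be parametrised by the Gauss angle through \<open>a (\<rho> \<theta>) = sin \<theta>\<close>, so that
  \<open>r\<^sub>1 = \<rho> / sin \<theta>\<close> and \<open>\<rho>' = r\<^sub>2 cos \<theta>\<close>, whence \<open>r\<^sub>1' = (r\<^sub>2 - r\<^sub>1) cot \<theta>\<close>.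

  For \<open>f = r\<^sub>1 - r\<^sub>0\<close> this says \<open>f' tan \<theta> / f \<longlonglongrightarrow> \<mu> - 1\<close>, and therefore \<open>f\<^sup>2 / sin\<^sup>2\<^sup>\<beta> \<theta>\<close> is increasing
  near 0 for \<open>\<beta> < \<mu> - 1\<close> and decreasing for \<open>\<beta> > \<mu> - 1\<close>. The first case gives (B). If \<open>\<mu> < \<alpha> + 1\<close>
  in (A), L'Hopital makes \<open>f / sin\<^sup>\<alpha> \<theta>\<close> converge, against the lower bound from the second case with
  \<open>\<mu> - 1 < \<beta> < \<alpha>\<close>. If \<open>\<mu> > \<alpha> + 1\<close>, then \<open>\<gamma> = 0\<close> by (B).
\<close>

section \<open>Asymptotics of the radii of curvature\<close>

text \<open>Where \<open>f x\<close> is nonzero, the logarithmic derivative of the product is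
  \<open>2 * (q - \<beta>) * cos x / sin x\<close>, so the sign of \<open>q - \<beta>\<close>
  decides its monotonicity. Squaring lets \<open>f\<close> have either sign.\<close>

lemma DERIV_square_div_sin_powr:
  fixes f :: "real \<Rightarrow> real"
  assumes f: "(f has_real_derivative f x * q * cos x / sin x) (at x)" and x: "sin x > 0"
  shows "((\<lambda>x. (f x)\<^sup>2 * sin x powr (- 2 * \<beta>)) has_real_derivative
           2 * (f x)\<^sup>2 * (q - \<beta>) * (cos x / sin x) * sin x powr (- 2 * \<beta>)) (at x)"
proof -
  have eq: "sin x powr (- 2 * \<beta> - 1) = sin x powr (- 2 * \<beta>) / sin x"
    using x by (simp add: powr_diff)
  show ?thesis
    apply (rule derivative_eq_intros f refl x)+
    using x by (simp only: eq) (simp add: divide_simps power2_eq_square, simp add: algebra_simps)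
qed

text \<open>The bound \<open>pi/2\<close> keeps sine and cosine positive on the interval.\<close>

lemma eventually_at_right_interval:
  fixes P :: "real \<Rightarrow> bool"
  assumes "eventually P (at_right 0)"
  obtains e where "0 < e" "e < pi/2" "\<And>x. 0 < x \<Longrightarrow> x < e \<Longrightarrow> P x"
proof -
  obtain b where b: "b > 0" "\<And>x. 0 < x \<Longrightarrow> x < b \<Longrightarrow> P x"
    using assms unfolding eventually_at_right_field by auto
  show ?thesis
    by (rule that[of "min b 1"]) (use b pi_gt3 in auto)
qed

text \<open>Since \<open>q\<close> tends to \<open>m\<close>, the sign of \<open>q - \<beta>\<close>
  is constant near 0 and the product is monotone there. If nondecreasing, it stays below its value
  at a fixed point; if nonincreasing, it stays above that value, which is positive because
  \<open>f\<close> has no zeros nearby. Up to constants, \<open>f\<close> is thus squeezed between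
  powers of the sine with exponents close to \<open>m\<close>.\<close>

lemma square_div_sin_powr_bounds:
  fixes f q :: "real \<Rightarrow> real"
  assumes f: "\<forall>\<^sub>F x in at_right 0. (f has_real_derivative f x * q x * cos x / sin x) (at x)"
    and ne: "\<forall>\<^sub>F x in at_right 0. f x \<noteq> 0"
    and q: "(q \<longlongrightarrow> m) (at_right 0)"
  shows square_div_sin_powr_upper:
      "\<beta> < m \<Longrightarrow> \<exists>C>0. \<forall>\<^sub>F x in at_right 0. (f x)\<^sup>2 * sin x powr (- 2 * \<beta>) \<le> C"
    and square_div_sin_powr_lower:
      "\<beta> > m \<Longrightarrow> \<exists>C>0. \<forall>\<^sub>F x in at_right 0. (f x)\<^sup>2 * sin x powr (- 2 * \<beta>) \<ge> C"
proof -
  define F where "F = (\<lambda>x. (f x)\<^sup>2 * sin x powr (- 2 * \<beta>))"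
  define F' where "F' = (\<lambda>x. 2 * (f x)\<^sup>2 * (q x - \<beta>) * (cos x / sin x) * sin x powr (- 2 * \<beta>))"
  {
    assume "\<beta> < m"
    then have "\<forall>\<^sub>F x in at_right 0. q x > \<beta>"
      using q by (simp add: order_tendsto_iff)
    with f ne have "\<forall>\<^sub>F x in at_right 0. (f has_real_derivative f x * q x * cos x / sin x) (at x) \<and> f x \<noteq> 0 \<and> q x > \<beta>"
      by eventually_elim auto
    then obtain e where e: "0 < e" "e < pi/2" 
      and P: "\<And>x. 0 < x \<Longrightarrow> x < e \<Longrightarrow> (f has_real_derivative f x * q x * cos x / sin x) (at x) \<and> f x \<noteq> 0 \<and> q x > \<beta>"
      by (rule eventually_at_right_interval) blast
    have sc: "sin x > 0" "cos x > 0" if "0 < x" "x < e" for x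
      using that e by (auto intro!: sin_gt_zero cos_gt_zero)
    have pos: "F x > 0" if "0 < x" "x < e" for x
      unfolding F_def using P[OF that] sc[OF that] by simp
    have mono: "F x \<le> F (e/2)" if x: "0 < x" "x \<le> e/2" for x
    proof (rule DERIV_nonneg_imp_nondecreasing[OF x(2)])
      fix y assume y: "x \<le> y" "y \<le> e/2"
      then have y': "0 < y" "y < e" using x e by auto
      have "DERIV F y :> F' y"
        unfolding F_def F'_def using P[OF y'] sc[OF y'] by (intro DERIV_square_div_sin_powr) auto
      moreover have "F' y \<ge> 0" unfolding F'_def using P[OF y'] sc[OF y'] by simp
      ultimately show "\<exists>z. DERIV F y :> z \<and> 0 \<le> z" by blast
    qed
    have "\<forall>\<^sub>F x in at_right 0. F x \<le> F (e/2)"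
      unfolding eventually_at_right_field using mono e by (intro exI[of _ "e/2"]) auto
    then show "\<exists>C>0. \<forall>\<^sub>F x in at_right 0. (f x)\<^sup>2 * sin x powr (- 2 * \<beta>) \<le> C"
      using pos[of "e/2"] e unfolding F_def by auto
  next
    assume "\<beta> > m"
    then have "\<forall>\<^sub>F x in at_right 0. q x < \<beta>"
      using q by (simp add: order_tendsto_iff)
    with f ne have "\<forall>\<^sub>F x in at_right 0. (f has_real_derivative f x * q x * cos x / sin x) (at x) \<and> f x \<noteq> 0 \<and> q x < \<beta>"
      by eventually_elim auto
    then obtain e where e: "0 < e" "e < pi/2" 
      and P: "\<And>x. 0 < x \<Longrightarrow> x < e \<Longrightarrow> (f has_real_derivative f x * q x * cos x / sin x) (at x) \<and> f x \<noteq> 0 \<and> q x < \<beta>"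
      by (rule eventually_at_right_interval) blast
    have sc: "sin x > 0" "cos x > 0" if "0 < x" "x < e" for x
      using that e by (auto intro!: sin_gt_zero cos_gt_zero)
    have pos: "F x > 0" if "0 < x" "x < e" for x
      unfolding F_def using P[OF that] sc[OF that] by simp
    have mono: "F x \<ge> F (e/2)" if x: "0 < x" "x \<le> e/2" for x
    proof (rule DERIV_nonpos_imp_nonincreasing[OF x(2)])
      fix y assume y: "x \<le> y" "y \<le> e/2"
      then have y': "0 < y" "y < e" using x e by auto
      have "DERIV F y :> F' y"
        unfolding F_def F'_def using P[OF y'] sc[OF y'] by (intro DERIV_square_div_sin_powr) auto
      moreover have "F' y \<le> 0" unfolding F'_def using P[OF y'] sc[OF y']
        by (intro mult_nonpos_nonneg mult_nonneg_nonpos) auto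
      ultimately show "\<exists>z. DERIV F y :> z \<and> z \<le> 0" by blast
    qed
    have "\<forall>\<^sub>F x in at_right 0. F x \<ge> F (e/2)"
      unfolding eventually_at_right_field using mono e by (intro exI[of _ "e/2"]) auto
    then show "\<exists>C>0. \<forall>\<^sub>F x in at_right 0. (f x)\<^sup>2 * sin x powr (- 2 * \<beta>) \<ge> C"
      using pos[of "e/2"] e unfolding F_def by auto
  }
qed

lemma sin_powr_tendsto_0:
  assumes "(a::real) > 0"
  shows "((\<lambda>x. sin x powr a) \<longlongrightarrow> 0) (at_right 0)"
proof -
  have s: "((\<lambda>x::real. sin x) \<longlongrightarrow> 0) (at_right 0)"
    using tendsto_sin[of "\<lambda>x. x" 0 "at_right (0::real)"] by (simp add: tendsto_ident_at)
  have p: "\<forall>\<^sub>F x::real in at_right 0. sin x \<ge> 0"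
    unfolding eventually_at_right_field by (intro exI[of _ pi]) (auto intro: sin_ge_zero)
  show ?thesis
    using tendsto_powr'[OF s tendsto_const[of a]] p assms by auto
qed

text \<open>The analytic core, free of geometry. With \<open>f = R1 - R0\<close> and
  \<open>q = (R2 - R1) / f\<close>, the slope hypothesis says that \<open>q\<close> tends to
  \<open>\<mu> - 1\<close>, and \<open>deriv\<close> becomes the equation to which the bounds on
  \<open>f\<close> apply.\<close>

lemma umbilic_slope_asymptotics:
  fixes R1 R2 :: "real \<Rightarrow> real"
  assumes deriv: "\<forall>\<^sub>F x in at_right 0. (R1 has_real_derivative (R2 x - R1 x) * cos x / sin x) (at x)"
    and lim: "(R1 \<longlongrightarrow> R0) (at_right 0)"
    and iso: "\<forall>\<^sub>F x in at_right 0. R1 x \<noteq> R2 x"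
    and slope: "((\<lambda>x. (R2 x - R0) / (R1 x - R0)) \<longlongrightarrow> \<mu>) (at_right 0)"
    and \<alpha>: "\<alpha> \<ge> 0"
  shows slope_lower_bound:
      "((\<lambda>x. (R2 x - R1 x) / sin x powr \<alpha>) \<longlongrightarrow> \<gamma>) (at_right 0) \<Longrightarrow> \<mu> \<ge> \<alpha> + 1"
    and radii_difference_tendsto_0:
      "\<mu> > \<alpha> + 1 \<Longrightarrow> ((\<lambda>x. (R2 x - R1 x) / sin x powr \<alpha>) \<longlongrightarrow> 0) (at_right 0)"
proof -
  define f where "f x = R1 x - R0" for x
  define q where "q x = (R2 x - R1 x) / f x" for x
  have sc0: "\<forall>\<^sub>F x::real in at_right 0. sin x > 0 \<and> cos x > 0"
    unfolding eventually_at_right_field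
    by (intro exI[of _ "pi/2"]) (auto intro: sin_gt_zero cos_gt_zero)
  have f0: "(f \<longlongrightarrow> 0) (at_right 0)"
    using tendsto_diff[OF lim tendsto_const[of R0]] unfolding f_def by simp
  have f': "\<forall>\<^sub>F x in at_right 0. (f has_real_derivative (R2 x - R1 x) * cos x / sin x) (at x)"
    using deriv unfolding f_def by eventually_elim (auto intro!: derivative_eq_intros)
  \<comment> \<open>A zero of \<open>f\<close> at \<open>x\<close>, together with the limit 0 at the
    origin, would by Rolle's theorem give a point in between where \<open>R1 = R2\<close>, against
    \<open>iso\<close>.\<close>
  have ne: "\<forall>\<^sub>F x in at_right 0. f x \<noteq> 0"
  proof -
    have "\<forall>\<^sub>F x in at_right 0. (f has_real_derivative (R2 x - R1 x) * cos x / sin x) (at x) \<and> R1 x \<noteq> R2 x"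
      using f' iso by eventually_elim auto
    then obtain e where e: "0 < e" "e < pi/2"
      and P: "\<And>x. 0 < x \<Longrightarrow> x < e \<Longrightarrow> (f has_real_derivative (R2 x - R1 x) * cos x / sin x) (at x) \<and> R1 x \<noteq> R2 x"
      by (rule eventually_at_right_interval) blast
    have "f x \<noteq> 0" if x: "0 < x" "x < e" for x
    proof
      assume fx: "f x = 0"
      \<comment> \<open>Only the limit of \<open>f\<close> at 0 is known, not its value, so the
        value is set to 0 to obtain continuity on the closed interval.\<close>
      define g where "g y = (if y \<le> 0 then 0 else f y)" for y
      have ev: "\<forall>\<^sub>F w in nhds y. g w = f w" if "0 < y" for y
        using eventually_nhds_in_open[of "{0<..}" y] that
        by (auto elim!: eventually_mono simp: g_def)
      have dg: "(g has_real_derivative (R2 y - R1 y) * cos y / sin y) (at y)" if "0 < y" "y < e" for y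
        using P[OF that] DERIV_cong_ev[OF refl ev[OF that(1)] refl] by blast
      have "continuous_on {0..x} g"
        unfolding continuous_on_eq_continuous_within
      proof
        fix y assume y: "y \<in> {0..x}"
        show "continuous (at y within {0..x}) g"
        proof (cases "y = 0")
          case True
          have "(g \<longlongrightarrow> 0) (at_right 0)"
            using f0 by (rule Lim_transform_eventually) (auto simp: eventually_at_right_field g_def intro!: exI[of _ 1])
          then have "(g \<longlongrightarrow> 0) (at 0 within {0..x})"
            by (simp add: at_within_Icc_at_right x)
          then show ?thesis using True by (simp add: continuous_within g_def)
        next
          case False
          then show ?thesis using dg[of y] y x
            by (auto intro: continuous_at_imp_continuous_at_within DERIV_isCont)
        qed
      qed
      moreover have "g 0 = g x" using fx by (simp add: g_def)
      moreover have "g differentiable (at y)" if "0 < y" "y < x" for y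
        using dg[of y] that x by (force simp: real_differentiable_def)
      ultimately obtain z where z: "0 < z" "z < x" "DERIV g z :> 0"
        using Rolle[of 0 x g] x by blast
      have "(R2 z - R1 z) * cos z / sin z = 0"
        using DERIV_unique[OF z(3) dg[of z]] z x by simp
      moreover have "sin z > 0" "cos z > 0"
        using z x e by (auto intro!: sin_gt_zero cos_gt_zero)
      ultimately show False using P[of z] z x by auto
    qed
    then show ?thesis unfolding eventually_at_right_field using e by auto
  qed
  have fq: "\<forall>\<^sub>F x in at_right 0. (f has_real_derivative f x * q x * cos x / sin x) (at x)"
    using f' ne by eventually_elim (simp add: q_def)
  have q: "(q \<longlongrightarrow> \<mu> - 1) (at_right 0)"
  proof -
    have "((\<lambda>x. (R2 x - R0) / (R1 x - R0) - 1) \<longlongrightarrow> \<mu> - 1) (at_right 0)"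
      by (intro tendsto_intros slope)
    then show ?thesis
      by (rule Lim_transform_eventually)
        (use ne in eventually_elim, auto simp: q_def f_def field_simps)
  qed
  have quot: "((\<lambda>x. f x * sin x powr (- \<beta>)) \<longlongrightarrow> 0) (at_right 0)" if "\<beta> < \<mu> - 1" for \<beta>
  proof -
    \<comment> \<open>Halfway between \<open>\<beta>\<close> and \<open>\<mu> - 1\<close>: the upper
      bound is available for \<open>b\<close>, and \<open>b - \<beta> > 0\<close> leaves a positive
      power of the sine, which tends to 0.\<close>
    define b where "b = (\<beta> + (\<mu> - 1)) / 2"
    have b: "b < \<mu> - 1" "\<beta> < b" using that by (auto simp: b_def)
    obtain C where C: "\<forall>\<^sub>F x in at_right 0. (f x)\<^sup>2 * sin x powr (- 2 * b) \<le> C"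
      using square_div_sin_powr_upper[OF fq ne q b(1)] by auto
    have "((\<lambda>x. (f x * sin x powr (- \<beta>))\<^sup>2) \<longlongrightarrow> 0) (at_right 0)"
    proof (rule tendsto_sandwich[OF _ _ tendsto_const])
      show "\<forall>\<^sub>F x in at_right 0. (f x * sin x powr (- \<beta>))\<^sup>2 \<le> C * sin x powr (2 * (b - \<beta>))"
        using C
      proof eventually_elim
        case (elim x)
        have "(f x * sin x powr (- \<beta>))\<^sup>2 = ((f x)\<^sup>2 * sin x powr (- 2 * b)) * sin x powr (2 * (b - \<beta>))"
          by (simp add: power_mult_distrib power2_eq_square flip: powr_add)
        also have "\<dots> \<le> C * sin x powr (2 * (b - \<beta>))"
          by (intro mult_right_mono elim) auto
        finally show ?case .
      qed
      show "((\<lambda>x. C * sin x powr (2 * (b - \<beta>))) \<longlongrightarrow> 0) (at_right 0)"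
        using tendsto_mult[OF tendsto_const[of C] sin_powr_tendsto_0[of "2 * (b - \<beta>)"]] b by simp
    qed auto
    then show ?thesis by (simp add: tendsto_null_power)
  qed
  have pw: "sin x powr (- \<beta>) = 1 / sin x powr \<beta>" for x \<beta> :: real
    by (simp add: powr_minus field_simps)
  {
    assume "\<mu> > \<alpha> + 1"
    then have "((\<lambda>x. q x * (f x * sin x powr (- \<alpha>))) \<longlongrightarrow> (\<mu> - 1) * 0) (at_right 0)"
      by (intro tendsto_mult q quot) auto
    then have "((\<lambda>x. q x * (f x * sin x powr (- \<alpha>))) \<longlongrightarrow> 0) (at_right 0)" by simp
    then show "((\<lambda>x. (R2 x - R1 x) / sin x powr \<alpha>) \<longlongrightarrow> 0) (at_right 0)"
      by (rule Lim_transform_eventually) (use ne in eventually_elim, auto simp: q_def pw)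
  next
    assume \<gamma>: "((\<lambda>x. (R2 x - R1 x) / sin x powr \<alpha>) \<longlongrightarrow> \<gamma>) (at_right 0)"
    have "\<exists>c. ((\<lambda>x. f x / sin x powr \<alpha>) \<longlongrightarrow> c) (at_right 0)"
    \<comment> \<open>For exponent 0 the denominator is 1 near 0 on the right and L'Hopital does not
      apply, but then the quotient is just \<open>f\<close>.\<close>
    proof (cases "\<alpha> = 0")
      case True
      have "((\<lambda>x. f x / sin x powr \<alpha>) \<longlongrightarrow> 0) (at_right 0)"
        using f0 by (rule Lim_transform_eventually) (use sc0 in eventually_elim, auto simp: True)
      then show ?thesis ..
    next
      case False
      then have a: "\<alpha> > 0" using \<alpha> by simp
      let ?g' = "\<lambda>x. \<alpha> * sin x powr \<alpha> * cos x / sin x"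
      \<comment> \<open>In the quotient of the derivatives the cotangents cancel, leaving
        \<open>(R2 - R1) / sin x powr \<alpha> / \<alpha>\<close>, whose limit is the hypothesis
        divided by \<open>\<alpha>\<close>.\<close>
      have "((\<lambda>x. f x / sin x powr \<alpha>) \<longlongrightarrow> \<gamma> / \<alpha>) (at_right 0)"
      proof (rule lhopital_right_0[OF f0 sin_powr_tendsto_0[OF a], where g' = ?g'])
        show "\<forall>\<^sub>F x in at_right 0. ((\<lambda>x. sin x powr \<alpha>) has_real_derivative ?g' x) (at x)"
          using sc0
        proof eventually_elim
          case (elim x)
          then have eq: "sin x powr (\<alpha> - 1) = sin x powr \<alpha> / sin x"
            by (simp add: powr_diff)
          show ?case
            by (rule derivative_eq_intros refl | use elim in \<open>simp add: eq; fail\<close>)+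
        qed
        have "((\<lambda>x. (R2 x - R1 x) / sin x powr \<alpha> / \<alpha>) \<longlongrightarrow> \<gamma> / \<alpha>) (at_right 0)"
          using \<gamma> a by (intro tendsto_intros) auto
        then show "((\<lambda>x. ((R2 x - R1 x) * cos x / sin x) / ?g' x) \<longlongrightarrow> \<gamma> / \<alpha>) (at_right 0)"
          by (rule Lim_transform_eventually) (use sc0 in eventually_elim, auto simp: divide_simps a)
      qed (use sc0 a f' in \<open>auto elim: eventually_mono\<close>)
      then show ?thesis ..
    qed
    then obtain c where c: "((\<lambda>x. f x / sin x powr \<alpha>) \<longlongrightarrow> c) (at_right 0)" ..
    show "\<mu> \<ge> \<alpha> + 1"
    proof (rule ccontr)
      assume "\<not> \<mu> \<ge> \<alpha> + 1"
      \<comment> \<open>With \<open>b > \<mu> - 1\<close> the product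
        \<open>(f x)\<^sup>2 * sin x powr (- 2 * b)\<close> stays above a positive constant. With
        \<open>b < \<alpha>\<close> convergence of \<open>f x / sin x powr \<alpha>\<close> forces
        it to 0.\<close>
      define b where "b = (\<alpha> + (\<mu> - 1)) / 2"
      have b: "b > \<mu> - 1" "b < \<alpha>" using \<open>\<not> \<mu> \<ge> \<alpha> + 1\<close> by (auto simp: b_def)
      obtain C where C: "C > 0" "\<forall>\<^sub>F x in at_right 0. (f x)\<^sup>2 * sin x powr (- 2 * b) \<ge> C"
        using square_div_sin_powr_lower[OF fq ne q b(1)] by auto
      have "((\<lambda>x. (f x / sin x powr \<alpha>)\<^sup>2 * sin x powr (2 * (\<alpha> - b))) \<longlongrightarrow> c\<^sup>2 * 0) (at_right 0)"
        using b by (intro tendsto_mult tendsto_power c sin_powr_tendsto_0) auto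
      moreover have "(f x / sin x powr \<alpha>)\<^sup>2 * sin x powr (2 * (\<alpha> - b)) = (f x)\<^sup>2 * sin x powr (- 2 * b)" for x
      proof -
        have "(f x / sin x powr \<alpha>)\<^sup>2 = (f x)\<^sup>2 * sin x powr (- 2 * \<alpha>)"
          by (simp add: divide_inverse power_mult_distrib power2_eq_square flip: powr_minus powr_add)
        then show ?thesis by (simp add: algebra_simps flip: powr_add)
      qed
      ultimately have "((\<lambda>x. (f x)\<^sup>2 * sin x powr (- 2 * b)) \<longlongrightarrow> 0) (at_right 0)" by simp
      then have "C \<le> 0"
        using C(2) tendsto_lowerbound trivial_limit_at_right_real by blast
      with C(1) show False by simp
    qed
  }
qed

section \<open>Graph charts with differentiable normal\<close>

text \<open>The derivative of normalisation \<open>x / norm x\<close>: the component of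
  \<open>v\<close> orthogonal to \<open>x\<close>, divided by \<open>norm x\<close>.\<close>

definition dsgn :: "'a::real_inner \<Rightarrow> 'a \<Rightarrow> 'a" where
  "dsgn x v = v /\<^sub>R norm x - ((x \<bullet> v) / norm x ^ 3) *\<^sub>R x"

lemma has_derivative_sgn:
  fixes x :: "'a::real_inner"
  assumes "x \<noteq> 0"
  shows "(sgn has_derivative dsgn x) (at x)"
proof -
  have "((\<lambda>x. inverse (norm x) *\<^sub>R x) has_derivative
      (\<lambda>h. inverse (norm x) *\<^sub>R h + (- (inverse (norm x) * (sgn x \<bullet> h) * inverse (norm x))) *\<^sub>R x)) (at x)"
    using has_derivative_scaleR[OF Deriv.has_derivative_inverse[OF _ has_derivative_norm[OF assms]] has_derivative_ident] assms
    by (simp add: inner_commute)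
  also have "(\<lambda>h. inverse (norm x) *\<^sub>R h + (- (inverse (norm x) * (sgn x \<bullet> h) * inverse (norm x))) *\<^sub>R x) = dsgn x"
    by (simp add: dsgn_def fun_eq_iff sgn_div_norm power3_eq_cube divide_inverse mult.assoc)
  finally show ?thesis by (simp add: sgn_div_norm[abs_def])
qed

lemma inner_3: "(x :: real^3) \<bullet> y = x$1 * y$1 + x$2 * y$2 + x$3 * y$3"
  by (simp add: inner_vec_def sum_3)

text \<open>Orthogonality to two vectors over the horizontal basis expresses the first two
  components through the third, and unit length then fixes the square of the third. Positivity picks
  the sign. This identifies the given normal with a cross product and later yields its rotational
  symmetry.\<close>

lemma unit_normal_unique:
  fixes n m x y :: "real^3"
  assumes xy: "x$1 = 1" "x$2 = 0" "y$1 = 0" "y$2 = 1"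
    and n: "n \<bullet> x = 0" "n \<bullet> y = 0" "norm n = 1" "n$3 > 0"
    and m: "m \<bullet> x = 0" "m \<bullet> y = 0" "norm m = 1" "m$3 > 0"
  shows "n = m"
proof -
  have sq: "(v$3)\<^sup>2 * (1 + (x$3)\<^sup>2 + (y$3)\<^sup>2) = 1 \<and> v$1 = - v$3 * x$3 \<and> v$2 = - v$3 * y$3"
    if "v \<bullet> x = 0" "v \<bullet> y = 0" "norm v = 1" for v :: "real^3"
  proof -
    have v: "v$1 = - v$3 * x$3" "v$2 = - v$3 * y$3"
      using that(1,2) xy by (auto simp: inner_3)
    have "v \<bullet> v = 1" using that(3) by (simp add: norm_eq_1)
    then show ?thesis unfolding inner_3 v
      by (simp add: v power2_eq_square algebra_simps)
  qed
  have "(n$3)\<^sup>2 * (1 + (x$3)\<^sup>2 + (y$3)\<^sup>2) = (m$3)\<^sup>2 * (1 + (x$3)\<^sup>2 + (y$3)\<^sup>2)"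
    using sq[OF n(1-3)] sq[OF m(1-3)] by simp
  moreover have "1 + (x$3)\<^sup>2 + (y$3)\<^sup>2 \<noteq> 0"
    by (metis add_pos_nonneg less_numeral_extra(1,3) zero_le_power2)
  ultimately have "(n$3)\<^sup>2 = (m$3)\<^sup>2" by simp
  then have "n$3 = m$3" using n(4) m(4) by simp
  then show ?thesis
    using sq[OF n(1-3)] sq[OF m(1-3)] by (simp add: vec_eq_iff forall_3)
qed

text \<open>The inverses converge because the limit operator is bounded below.\<close>

lemma tendsto_preimage_blinfun:
  fixes L :: "'a \<Rightarrow> 'b::euclidean_space \<Rightarrow>\<^sub>L 'b" and L0 :: "'b \<Rightarrow>\<^sub>L 'b"
  assumes L: "(L \<longlongrightarrow> L0) F" and inj: "inj (blinfun_apply L0)"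
    and w: "\<forall>\<^sub>F x in F. L x (w x) = L0 w0"
  shows "(w \<longlongrightarrow> w0) F"
proof -
  obtain m where m: "m > 0" "\<And>v. norm (L0 v) \<ge> m * norm v"
    using linear_inj_bounded_below_pos[of "blinfun_apply L0"] inj
      bounded_linear.linear[OF blinfun.bounded_linear_right] by metis
  have d0: "((\<lambda>x. norm (L0 - L x)) \<longlongrightarrow> 0) F"
    using tendsto_norm[OF tendsto_diff[OF tendsto_const[of L0] L]] by simp
  have ev: "\<forall>\<^sub>F x in F. norm (L0 - L x) < m / 2"
    using order_tendstoD(2)[OF d0, of "m/2"] m by simp
  have "((\<lambda>x. norm (L0 - L x) * (2 * norm w0 / m)) \<longlongrightarrow> 0) F"
    using tendsto_mult[OF d0 tendsto_const[of "2 * norm w0 / m"]] by simp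
  then have "((\<lambda>x. norm (w x - w0)) \<longlongrightarrow> 0) F"
  proof (rule tendsto_sandwich[rotated 2, OF tendsto_const])
    show "\<forall>\<^sub>F x in F. norm (w x - w0) \<le> norm (L0 - L x) * (2 * norm w0 / m)"
      using ev w
    proof eventually_elim
      case (elim x)
      define d where "d = norm (L0 - L x)"
      have "L0 (w x - w0) = (L0 - L x) (w x)"
        using elim(2) by (simp add: blinfun.diff_left blinfun.diff_right)
      then have "m * norm (w x - w0) \<le> d * norm (w x)"
        using m(2)[of "w x - w0"] norm_blinfun[of "L0 - L x" "w x"] by (simp add: d_def)
      also have "\<dots> \<le> d * (norm (w x - w0) + norm w0)"
        unfolding d_def using norm_triangle_ineq[of "w x - w0" w0] by (intro mult_left_mono) auto
      \<comment> \<open>As \<open>norm (L0 - L x) < m / 2\<close>, the error term on the right is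
        absorbed by half of the left-hand side.\<close>
      also have "\<dots> \<le> m / 2 * norm (w x - w0) + d * norm w0"
        using mult_right_mono[of d "m / 2" "norm (w x - w0)"] elim(1) by (simp add: d_def distrib_left)
      finally show ?case using m(1) unfolding d_def[symmetric] by (simp add: field_simps)
    qed
  qed auto
  then show ?thesis using Lim_null tendsto_norm_zero_iff by metis
qed


definition proj12 :: "real^3 \<Rightarrow> real^2" where
  "proj12 v = vector [v$1, v$2]"

lemma proj12_nth [simp]: "proj12 v $ 1 = v $ 1" "proj12 v $ 2 = v $ 2"
  by (simp_all add: proj12_def)

lemma bounded_linear_proj12: "bounded_linear proj12"
  by (rule linear_conv_bounded_linear[THEN iffD1], rule linearI)
    (simp_all add: vec_eq_iff forall_2)

lemma bounded_bilinear_cross3: "bounded_bilinear cross3"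
  using bilinear_cross by (simp add: bilinear_conv_bounded_bilinear)

text \<open>The image under \<open>X\<close> of the straight line through \<open>u\<close> in
  direction \<open>v\<close> is a curve in \<open>S\<close> with velocity
  \<open>X' v\<close>.\<close>

lemma tangent_space_patch:
  fixes X :: "real^2 \<Rightarrow> real^3"
  assumes U: "open U" "u \<in> U" "X ` U \<subseteq> S" and X: "(X has_derivative X') (at u)"
  shows "X' v \<in> tangent_space S (X u)"
proof -
  obtain e where e: "e > 0" "ball u e \<subseteq> U"
    using U open_contains_ball by blast
  \<comment> \<open>The added 1 keeps the quotient meaningful for \<open>v = 0\<close>.\<close>
  define d where "d = e / (norm v + 1)"
  have d: "d > 0" using e by (simp add: d_def add_nonneg_pos)
  have "X (u + t *\<^sub>R v) \<in> S" if "\<bar>t\<bar> < d" for t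
  proof -
    have "\<bar>t\<bar> * norm v \<le> \<bar>t\<bar> * (norm v + 1)" by (simp add: mult_left_mono)
    also have "\<dots> < e" using that by (simp add: d_def pos_less_divide_eq add_nonneg_pos)
    finally have "u + t *\<^sub>R v \<in> ball u e" by (simp add: dist_norm)
    then show ?thesis using e U by blast
  qed
  moreover have "((\<lambda>t. X (u + t *\<^sub>R v)) has_vector_derivative X' v) (at 0)"
  proof -
    have 1: "((\<lambda>t::real. u + t *\<^sub>R v) has_derivative (\<lambda>t. t *\<^sub>R v)) (at 0)"
      by (auto intro!: derivative_eq_intros)
    have "((\<lambda>t. X (u + t *\<^sub>R v)) has_derivative (\<lambda>t. X' (t *\<^sub>R v))) (at 0)"
      using has_derivative_compose[OF 1, of X X'] X by simp
    then show ?thesis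
      using linear_scale[OF has_derivative_linear[OF X]] by (simp add: has_vector_derivative_def)
  qed
  ultimately show ?thesis
    unfolding tangent_space_def using d by (auto intro!: exI[of _ "\<lambda>t. X (u + t *\<^sub>R v)"] exI[of _ d])
qed

lemma axis_decompose_2: "v = (v$1) *\<^sub>R axis 1 1 + (v$2) *\<^sub>R axis 2 (1::real)" for v :: "real^2"
  by (simp add: vec_eq_iff forall_2 axis_def)

text \<open>The tangent plane at \<open>p\<close> is horizontal, so the horizontal projection of a
  patch has a local inverse \<open>g\<close>, and \<open>X \<circ> g\<close> is a graph. Its upward
  normal is the normalised cross product of the partial derivatives of \<open>X\<close>, which is
  differentiable because \<open>X\<close> is twice differentiable. Continuity of the derivative is
  recorded at the projection of \<open>p\<close> alone: it is what inverting the Gauss angle near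
  \<open>p\<close> requires.\<close>

lemma graph_chart:
  fixes S :: "(real^3) set"
  assumes surf: "C2_regular_surface S" and normal: "unit_normal_field S N"
    and p: "p \<in> S" and Np: "N p = axis 3 1"
  obtains T V \<zeta> \<zeta>' n n' where "open T" "p \<in> T" "open V" "S \<inter> T = \<zeta> ` V"
    "\<And>x. x \<in> V \<Longrightarrow> proj12 (\<zeta> x) = x"
    "\<And>x. x \<in> V \<Longrightarrow> (\<zeta> has_derivative \<zeta>' x) (at x)"
    "\<And>x w. x \<in> V \<Longrightarrow> proj12 (\<zeta>' x w) = w"
    "\<And>x. x \<in> V \<Longrightarrow> N (\<zeta> x) = n x"
    "\<And>x. x \<in> V \<Longrightarrow> n x $ 3 > 0"
    "\<And>x. x \<in> V \<Longrightarrow> (n has_derivative n' x) (at x)"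
    "\<And>w. ((\<lambda>x. n' x w) \<longlongrightarrow> n' (proj12 p) w) (at (proj12 p))"
proof -
  obtain X U where patch: "C2_patch S X U" and pX: "p \<in> X ` U"
    using surf p unfolding C2_regular_surface_def by blast
  then obtain u0 where u0: "u0 \<in> U" "X u0 = p" by blast
  from patch obtain Y where oU: "open U" and C2: "C2_on X U"
    and inj: "\<And>u. u \<in> U \<Longrightarrow> inj (frechet_derivative X (at u))"
    and XUo: "openin (top_of_set S) (X ` U)" and hom: "homeomorphism U (X ` U) X Y"
    unfolding C2_patch_def by blast
  have XU: "X ` U \<subseteq> S" using XUo by (rule openin_imp_subset)
  from C2 obtain D :: "real^2 \<Rightarrow> ((real^2) \<Rightarrow>\<^sub>L (real^3))" and D2
    where D: "\<And>u. u \<in> U \<Longrightarrow> (X has_derivative blinfun_apply (D u)) (at u)"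
      and D2: "\<And>u. u \<in> U \<Longrightarrow> (D has_derivative blinfun_apply (D2 u)) (at u)"
      and contD2: "continuous_on U D2"
    unfolding C2_on_def by blast
  have injD: "inj (blinfun_apply (D u))" if "u \<in> U" for u
    using inj[OF that] frechet_derivative_at[OF D[OF that]] by simp
  have contX: "continuous_on U X"
    using D by (meson continuous_at_imp_continuous_on has_derivative_continuous)
  have contD: "continuous_on U D"
    using D2 by (meson continuous_at_imp_continuous_on has_derivative_continuous)
  have contN: "continuous_on S N" and normN: "\<And>q. q \<in> S \<Longrightarrow> norm (N q) = 1"
    and orthN: "\<And>q v. q \<in> S \<Longrightarrow> v \<in> tangent_space S q \<Longrightarrow> N q \<bullet> v = 0"
    using normal unfolding unit_normal_field_def by auto
  have NX: "N (X u) \<bullet> D u v = 0" if "u \<in> U" for u v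
    using orthN tangent_space_patch[OF oU that XU D[OF that]] XU that by blast

  \<comment> \<open>An upward normal field on the patch\<close>
  define M0 where "M0 u = cross3 (D u (axis 1 1)) (D u (axis 2 1))" for u
  have D_axis: "D u v = (v$1) *\<^sub>R D u (axis 1 1) + (v$2) *\<^sub>R D u (axis 2 1)" for u v
    by (subst axis_decompose_2) (simp only: blinfun.add_right blinfun.scaleR_right)
  have M0_orth: "M0 u \<bullet> D u v = 0" for u v
    by (subst D_axis) (simp add: M0_def inner_add_right dot_cross_self)
  have M0_ne: "M0 u \<noteq> 0" if u: "u \<in> U" for u
  proof
    assume "M0 u = 0"
    then have "D u (axis 1 1) = 0 \<or> D u (axis 2 1) = 0 \<or> (\<exists>c. D u (axis 2 1) = c *\<^sub>R D u (axis 1 1))"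
      unfolding M0_def cross_eq_0 collinear_lemma .
    then have "D u (axis 1 1) = D u 0 \<or> D u (axis 2 1) = D u 0 \<or> (\<exists>c. D u (axis 2 1) = D u (c *\<^sub>R axis 1 1))"
      by (simp add: blinfun.scaleR_right)
    then have "axis 1 1 = (0 :: real^2) \<or> axis 2 1 = (0 :: real^2) \<or> (\<exists>c. axis 2 1 = c *\<^sub>R (axis 1 1 :: real^2))"
      unfolding inj_eq[OF injD[OF u]] .
    then show False by (auto simp: vec_eq_iff forall_2 axis_def)
  qed
  \<comment> \<open>The normal at \<open>p\<close> is vertical, so tangent vectors there are
    horizontal. Hence \<open>M0 u0\<close> is vertical, and projecting loses nothing of
    \<open>D u0\<close>, which gives \<open>injP\<close>.\<close>
  have D3: "D u0 v $ 3 = 0" for v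
    using NX[OF u0(1), of v] Np u0(2) by (simp add: inner_axis')
  have "M0 u0 $ 1 = 0" "M0 u0 $ 2 = 0"
    using D3 by (simp_all add: M0_def cross_components)
  then have M0_3: "M0 u0 $ 3 \<noteq> 0"
    using M0_ne[OF u0(1)] by (simp add: vec_eq_iff forall_3)
  \<comment> \<open>The sign makes \<open>M u0\<close> point upward, in agreement with
    \<open>N p\<close>.\<close>
  define M where "M u = sgn (M0 u0 $ 3) *\<^sub>R M0 u" for u
  have M_orth: "M u \<bullet> D u v = 0" for u v by (simp add: M_def M0_orth)
  have contM: "continuous_on U M"
    unfolding M_def M0_def
    by (intro continuous_intros continuous_on_cross contD)
  \<comment> \<open>Uniqueness of the unit normal needs both candidates to point upward, so the
    patch is cut down to where \<open>M\<close> and the given normal do.\<close>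
  define U1 where "U1 = (U \<inter> (\<lambda>u. M u $ 3) -` {0<..}) \<inter> (U \<inter> (\<lambda>u. N (X u) $ 3) -` {0<..})"
  have "continuous_on U (\<lambda>u. N (X u) $ 3)"
    by (intro continuous_intros continuous_on_compose2[OF contN contX] XU)
  moreover have "continuous_on U (\<lambda>u. M u $ 3)"
    by (intro continuous_intros contM)
  ultimately have oU1: "open U1"
    unfolding U1_def by (intro open_Int continuous_open_preimage oU open_greaterThan)
  have U1U: "U1 \<subseteq> U" by (auto simp: U1_def)
  have u0U1: "u0 \<in> U1"
    using u0 M0_3 Np by (auto simp: U1_def M_def sgn_if axis_def)

  \<comment> \<open>Inverting the horizontal projection of the patch\<close>
  define P where "P = Blinfun proj12"
  have P: "blinfun_apply P = proj12"
    unfolding P_def by (rule bounded_linear_Blinfun_apply[OF bounded_linear_proj12])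
  have Papp: "blinfun_apply (P o\<^sub>L D u) = (\<lambda>v. proj12 (D u v))" for u
    by (simp add: fun_eq_iff P)
  have PX: "((\<lambda>u. proj12 (X u)) has_derivative blinfun_apply (P o\<^sub>L D u)) (at u)" if "u \<in> U" for u
    unfolding Papp by (rule bounded_linear.has_derivative[OF bounded_linear_proj12 D[OF that]])
  have contP: "continuous_on U1 (\<lambda>u. P o\<^sub>L D u)"
    by (intro continuous_intros continuous_on_subset[OF contD U1U])
  have injP: "inj (blinfun_apply (P o\<^sub>L D u0))"
  proof (rule injI)
    fix x y assume "blinfun_apply (P o\<^sub>L D u0) x = blinfun_apply (P o\<^sub>L D u0) y"
    then have "D u0 x = D u0 y"
      using D3 by (simp add: P vec_eq_iff forall_2 forall_3)
    then show "x = y" using injD[OF u0(1)] by (simp add: inj_eq)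
  qed
  obtain invf where invf: "invf o\<^sub>L (P o\<^sub>L D u0) = id_blinfun"
  proof -
    obtain h where h: "linear h" "h \<circ> blinfun_apply (P o\<^sub>L D u0) = id"
      using linear_injective_left_inverse[OF bounded_linear.linear[OF blinfun.bounded_linear_right] injP] by blast
    have "Blinfun h o\<^sub>L (P o\<^sub>L D u0) = id_blinfun"
      using h by (intro blinfun_eqI)
        (simp add: bounded_linear_Blinfun_apply linear_conv_bounded_linear fun_eq_iff)
    then show ?thesis by (rule that)
  qed
  obtain U' V g g' where oU': "open U'" and U': "U' \<subseteq> U1" and u0': "u0 \<in> U'" and oV: "open V"
    and pV: "proj12 (X u0) \<in> V" and homg: "homeomorphism U' V (\<lambda>u. proj12 (X u)) g"
    and g: "\<And>y. y \<in> V \<Longrightarrow> (g has_derivative g' y) (at y)"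
    and g': "\<And>y. y \<in> V \<Longrightarrow> g' y = inv (blinfun_apply (P o\<^sub>L D (g y)))"
    and bij: "\<And>y. y \<in> V \<Longrightarrow> bij (blinfun_apply (P o\<^sub>L D (g y)))"
  proof (rule inverse_function_theorem[OF oU1 _ contP u0U1 invf])
    show "((\<lambda>u. proj12 (X u)) has_derivative blinfun_apply (P o\<^sub>L D u)) (at u)" if "u \<in> U1" for u
      using PX U1U that by blast
  qed (rule that)
  have gV: "g y \<in> U'" if "y \<in> V" for y
    using homg that unfolding homeomorphism_def by blast
  have gU: "g y \<in> U" "g y \<in> U1" if "y \<in> V" for y
    using gV[OF that] U' U1U by auto
  have Pg: "proj12 (X (g y)) = y" if "y \<in> V" for y
    using homg that unfolding homeomorphism_def by blast
  have gp: "g (proj12 p) = u0"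
    using homg u0 u0' unfolding homeomorphism_def by blast
  have Lg: "(P o\<^sub>L D (g y)) (g' y w) = w" if "y \<in> V" for y w
    unfolding g'[OF that] by (rule surj_f_inv_f[OF bij_is_surj[OF bij[OF that]]])

  \<comment> \<open>\<open>X\<close> is a homeomorphism onto a set open in \<open>S\<close>, so the
    smaller image is open in \<open>S\<close> too. Hence \<open>S \<inter> T\<close> is exactly the
    graph, with no further sheet of \<open>S\<close> inside \<open>T\<close>.\<close>
  have "openin (top_of_set (X ` U)) (X ` U')"
    using homeomorphism_imp_open_map[OF hom, of U'] oU' U' U1U oU
    by (metis inf.absorb_iff2 openin_open order_trans)
  then have "openin (top_of_set S) (X ` U')"
    using XUo openin_trans by blast
  then obtain T where T: "open T" "X ` U' = S \<inter> T"
    unfolding openin_open by blast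
  have gVeq: "g ` V = U'" using homg unfolding homeomorphism_def by blast
  have ST: "S \<inter> T = (\<lambda>y. X (g y)) ` V"
    unfolding T(2)[symmetric] gVeq[symmetric] by (simp add: image_image)

  \<comment> \<open>The normal and its derivative in the graph chart\<close>
  define DM where "DM u v = sgn (M0 u0 $ 3) *\<^sub>R
      (cross3 (D u (axis 1 1)) (D2 u v (axis 2 1)) + cross3 (D2 u v (axis 1 1)) (D u (axis 2 1)))" for u v
  have De: "((\<lambda>u. D u e) has_derivative (\<lambda>v. D2 u v e)) (at u)" if "u \<in> U" for u e
    using bounded_linear.has_derivative[OF blinfun.bounded_linear_left D2[OF that]] .
  have dM: "(M has_derivative DM u) (at u)" if "u \<in> U" for u
    unfolding M_def[abs_def] DM_def[abs_def] M0_def[abs_def]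
    by (intro has_derivative_scaleR_right bounded_bilinear.FDERIV[OF bounded_bilinear_cross3] De that)
  have M_ne: "M u \<noteq> 0" if "u \<in> U1" for u
    using that by (auto simp: U1_def)
  have dn: "((\<lambda>y. sgn (M (g y))) has_derivative (\<lambda>w. dsgn (M (g y)) (DM (g y) (g' y w)))) (at y)"
    if "y \<in> V" for y
    using has_derivative_compose[OF has_derivative_compose[OF g[OF that] dM[OF gU(1)[OF that]]]
        has_derivative_sgn[OF M_ne[OF gU(2)[OF that]]]] .
  have d\<zeta>: "((\<lambda>y. X (g y)) has_derivative (\<lambda>w. D (g y) (g' y w))) (at y)" if "y \<in> V" for y
    using has_derivative_compose[OF g[OF that] D[OF gU(1)[OF that]]] .
  have Pd: "proj12 (D (g y) (g' y w)) = w" if "y \<in> V" for y w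
    using Lg[OF that] by (simp add: P)
  have sgn_M3: "sgn (M u) $ 3 > 0" if "u \<in> U1" for u
    using that M_ne[OF that] by (simp add: sgn_div_norm U1_def)
  have N\<zeta>: "N (X (g y)) = sgn (M (g y))" if y: "y \<in> V" for y
  proof (rule unit_normal_unique)
    let ?w = "\<lambda>k. D (g y) (g' y (axis k 1))"
    have "proj12 (?w k) $ 1 = axis k 1 $ 1" "proj12 (?w k) $ 2 = axis k 1 $ 2" for k
      using Pd[OF y, of "axis k 1"] by (simp_all flip: proj12_nth)
    then show "?w 1 $ 1 = 1" "?w 1 $ 2 = 0" "?w 2 $ 1 = 0" "?w 2 $ 2 = 1"
      by (simp_all add: axis_def)
    show "N (X (g y)) \<bullet> ?w 1 = 0" "N (X (g y)) \<bullet> ?w 2 = 0"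
      using NX[OF gU(1)[OF y]] by auto
    show "norm (N (X (g y))) = 1" using normN XU gU(1)[OF y] by blast
    show "N (X (g y)) $ 3 > 0" using gU(2)[OF y] by (simp add: U1_def)
    show "sgn (M (g y)) \<bullet> ?w 1 = 0" "sgn (M (g y)) \<bullet> ?w 2 = 0"
      by (simp_all add: sgn_div_norm M_orth)
    show "norm (sgn (M (g y))) = 1" using M_ne[OF gU(2)[OF y]] by (simp add: norm_sgn)
    show "sgn (M (g y)) $ 3 > 0" by (rule sgn_M3[OF gU(2)[OF y]])
  qed
  let ?y0 = "proj12 p"
  have y0: "?y0 \<in> V" using pV u0 by simp
  have glim: "(g \<longlongrightarrow> u0) (at ?y0)"
    using has_derivative_continuous[OF g[OF y0]] gp by (simp add: continuous_at)
  have Mlim: "((\<lambda>y. M (g y)) \<longlongrightarrow> M u0) (at ?y0)"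
    using has_derivative_continuous[OF dM[OF u0(1)]] glim isCont_tendsto_compose by blast
  have Dlim: "((\<lambda>y. D (g y)) \<longlongrightarrow> D u0) (at ?y0)"
    using has_derivative_continuous[OF D2[OF u0(1)]] glim isCont_tendsto_compose by blast
  have D2lim: "((\<lambda>y. D2 (g y)) \<longlongrightarrow> D2 u0) (at ?y0)"
    using contD2 oU u0(1) glim isCont_tendsto_compose continuous_on_eq_continuous_at by blast
  have lim: "((\<lambda>y. dsgn (M (g y)) (DM (g y) (g' y w))) \<longlongrightarrow> dsgn (M (g ?y0)) (DM (g ?y0) (g' ?y0 w))) (at ?y0)" for w
  proof -
    \<comment> \<open>By \<open>Lg\<close>, \<open>g' y w\<close> is the preimage of the fixed
      vector \<open>w\<close> under \<open>P o\<^sub>L D (g y)\<close>, so its convergence follows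
      from that of the operators.\<close>
    have "((\<lambda>y. g' y w) \<longlongrightarrow> g' ?y0 w) (at ?y0)"
    proof (rule tendsto_preimage_blinfun)
      show "((\<lambda>y. P o\<^sub>L D (g y)) \<longlongrightarrow> P o\<^sub>L D u0) (at ?y0)"
        by (intro tendsto_intros Dlim)
      show "inj (blinfun_apply (P o\<^sub>L D u0))" by (rule injP)
      have "\<forall>\<^sub>F y in at ?y0. y \<in> V"
        using oV y0 by (rule eventually_at_in_open')
      then show "\<forall>\<^sub>F y in at ?y0. (P o\<^sub>L D (g y)) (g' y w) = (P o\<^sub>L D u0) (g' ?y0 w)"
        by eventually_elim (use Lg Lg[OF y0] gp in auto)
    qed
    then have "((\<lambda>y. DM (g y) (g' y w)) \<longlongrightarrow> DM u0 (g' ?y0 w)) (at ?y0)"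
      unfolding DM_def
      by (intro tendsto_intros bounded_bilinear.tendsto[OF bounded_bilinear_cross3] blinfun.tendsto Dlim D2lim)
    then show ?thesis
      unfolding dsgn_def gp using M_ne[OF u0U1] by (intro tendsto_intros Mlim) auto
  qed
  show ?thesis
    by (rule that[OF T(1) _ oV ST Pg d\<zeta> Pd N\<zeta> sgn_M3[OF gU(2)] dn lim]) (use T u0 u0' in auto)
qed

section \<open>Curvatures along the profile curve\<close>

text \<open>The chain rule along a curve that stays in \<open>S\<close> near 0. It evaluates any
  derivative of \<open>N\<close> within \<open>S\<close> on a tangent vector, which is all that such
  a derivative determines, and so gives the eigenvalues without choosing a particular
  \<open>A\<close>.\<close>

lemma dN_along_curve:
  assumes A: "(N has_derivative A) (at q within S)"
    and c: "\<forall>\<^sub>F t in nhds 0. c t \<in> S" "c 0 = q" "(c has_vector_derivative v) (at (0::real))"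
    and Nc: "((\<lambda>t. N (c t)) has_vector_derivative w) (at 0)"
  shows "A v = w"
proof -
  obtain e where e: "e > 0" "\<And>t. \<bar>t\<bar> < e \<Longrightarrow> c t \<in> S"
    using c(1) unfolding eventually_nhds_metric by (auto simp: dist_real_def)
  let ?I = "{-e<..<e}"
  have c': "(c has_derivative (\<lambda>h. h *\<^sub>R v)) (at 0 within ?I)"
    using c(3) by (simp add: has_vector_derivative_def has_derivative_at_withinI)
  have "(N has_derivative A) (at (c 0) within c ` ?I)"
    unfolding c(2) by (rule has_derivative_subset[OF A]) (use e in auto)
  then have "((\<lambda>t. N (c t)) has_derivative (\<lambda>h. A (h *\<^sub>R v))) (at 0 within ?I)"
    using has_derivative_in_compose[OF c'] by blast
  then have "((\<lambda>t. N (c t)) has_derivative (\<lambda>h. A (h *\<^sub>R v))) (at 0)"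
    using e(1) by (simp add: at_within_open[of 0 ?I])
  moreover have "(\<lambda>h. A (h *\<^sub>R v)) = (\<lambda>h. h *\<^sub>R A v)"
    using linear_scale[OF has_derivative_linear[OF A]] by auto
  ultimately have "((\<lambda>t. N (c t)) has_vector_derivative A v) (at 0)"
    by (simp add: has_vector_derivative_def)
  then show ?thesis using Nc by (rule vector_derivative_unique_at)
qed

lemma isCont_eventually_in_open:
  assumes "isCont f x" "open T" "f x \<in> T"
  shows "\<forall>\<^sub>F y in nhds x. f y \<in> T"
  using topological_tendstoD[of f "f x" "nhds x" T] assms
  by (simp add: isCont_def tendsto_at_iff_tendsto_nhds)

lemma has_vector_derivative_translate:
  fixes t :: real
  assumes "(f has_vector_derivative D) (at t)"
  shows "((\<lambda>h. f (t + h)) has_vector_derivative D) (at 0)"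
proof -
  have "((\<lambda>h. t + h) has_vector_derivative 1) (at 0)"
    by (auto intro!: derivative_eq_intros)
  then show ?thesis
    using vector_diff_chain_at[of "\<lambda>h. t + h" 1 0 f D] assms by (simp add: o_def)
qed

lemma has_vector_derivative_transform_nhds:
  assumes "(f has_vector_derivative D) (at x)" "\<forall>\<^sub>F y in nhds x. f y = g y"
  shows "(g has_vector_derivative D) (at x)"
  using assms(1) has_vector_derivative_cong_ev[of UNIV f g x D] assms(2) eventually_nhds_x_imp_x[OF assms(2)]
  by simp

lemma tangent_spaceI:
  assumes c: "\<forall>\<^sub>F t in nhds 0. c t \<in> S" "c 0 = q" "(c has_vector_derivative v) (at (0::real))"
  shows "v \<in> tangent_space S q"
proof -
  obtain e where "e > 0" "\<And>t. \<bar>t\<bar> < e \<Longrightarrow> c t \<in> S"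
    using c(1) unfolding eventually_nhds_metric by (auto simp: dist_real_def)
  then show ?thesis unfolding tangent_space_def using c(2,3)
    by (intro CollectI exI[of _ c]) auto
qed

section \<open>Rotations about the axis\<close>

lemma rotz_nth [simp]:
  "rotz \<phi> v $ 1 = cos \<phi> * v$1 - sin \<phi> * v$2"
  "rotz \<phi> v $ 2 = sin \<phi> * v$1 + cos \<phi> * v$2"
  "rotz \<phi> v $ 3 = v$3"
  by (simp_all add: rotz_def)

lemma rotz_0 [simp]: "rotz 0 v = v"
  by (simp add: vec_eq_iff forall_3)

lemma rotz_rotz: "rotz \<phi> (rotz \<psi> v) = rotz (\<phi> + \<psi>) v"
  by (simp add: vec_eq_iff forall_3 cos_add sin_add algebra_simps)

lemma bounded_linear_rotz: "bounded_linear (rotz \<phi>)"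
  by (rule linear_conv_bounded_linear[THEN iffD1], rule linearI)
    (simp_all add: vec_eq_iff forall_3 algebra_simps)

lemma rotz_scaleR: "rotz \<phi> (c *\<^sub>R v) = c *\<^sub>R rotz \<phi> v"
  using linear_scale[OF bounded_linear.linear[OF bounded_linear_rotz]] .

lemma inner_rotz: "rotz \<phi> u \<bullet> v = u \<bullet> rotz (- \<phi>) v"
  by (simp add: inner_3 algebra_simps)

lemma norm_rotz [simp]: "norm (rotz \<phi> v) = norm v"
  by (simp add: norm_eq_sqrt_inner inner_rotz rotz_rotz)

lemma rotz_on_axis: "on_axis p \<Longrightarrow> rotz \<phi> p = p"
  by (simp add: on_axis_def vec_eq_iff forall_3)

text \<open>The velocity of the parallel through \<open>v\<close>, found by splitting the rotation
  into a cosine, a sine and a constant part.\<close>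

lemma rotz_has_vector_derivative:
  "((\<lambda>\<phi>. rotz \<phi> v) has_vector_derivative (vector [- v$2, v$1, 0])) (at 0)"
proof -
  have "(\<lambda>\<phi>. rotz \<phi> v) = (\<lambda>\<phi>. cos \<phi> *\<^sub>R vector [v$1, v$2, 0] + sin \<phi> *\<^sub>R vector [- v$2, v$1, 0] + vector [0, 0, v$3])"
    by (simp add: fun_eq_iff vec_eq_iff forall_3)
  moreover have "(cos has_vector_derivative 0) (at (0::real))" "(sin has_vector_derivative 1) (at (0::real))"
    using DERIV_cos[of "0::real"] DERIV_sin[of "0::real"]
    by (simp_all add: has_real_derivative_iff_has_vector_derivative)
  note bounded_linear.has_vector_derivative[OF bounded_linear_scaleR_left this(1), of "vector [v$1, v$2, 0] :: real^3"]
    bounded_linear.has_vector_derivative[OF bounded_linear_scaleR_left this(2), of "vector [- v$2, v$1, 0] :: real^3"]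
  from has_vector_derivative_add[OF has_vector_derivative_add[OF this] has_vector_derivative_const]
  have "((\<lambda>\<phi>. cos \<phi> *\<^sub>R vector [v$1, v$2, 0] + sin \<phi> *\<^sub>R vector [- v$2, v$1, 0] + vector [0, 0, v$3])
      has_vector_derivative (vector [- v$2, v$1, 0] :: real^3)) (at 0)"
    by simp
  ultimately show ?thesis by simp
qed

lemma isCont_rotz: "isCont (\<lambda>\<phi>. rotz \<phi> v) 0"
  by (rule has_vector_derivative_continuous[OF rotz_has_vector_derivative])

lemma tangent_space_rotz:
  assumes inv: "\<And>\<phi>. rotz \<phi> ` S = S" and v: "v \<in> tangent_space S q"
  shows "rotz \<phi> v \<in> tangent_space S (rotz \<phi> q)"
proof -
  obtain c e where c: "e > 0" "\<forall>t::real. \<bar>t\<bar> < e \<longrightarrow> c t \<in> S" "c 0 = q"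
    "(c has_vector_derivative v) (at 0)"
    using v unfolding tangent_space_def by blast
  have "((\<lambda>t. rotz \<phi> (c t)) has_vector_derivative rotz \<phi> v) (at 0)"
    by (rule bounded_linear.has_vector_derivative[OF bounded_linear_rotz c(4)])
  moreover have "\<forall>t. \<bar>t\<bar> < e \<longrightarrow> rotz \<phi> (c t) \<in> S" using inv c(2) by blast
  ultimately show ?thesis
    unfolding tangent_space_def using c(1,3)
    by (intro CollectI exI[of _ "\<lambda>t. rotz \<phi> (c t)"] exI[of _ e]) simp
qed

lemma meridian_plane_0: "meridian_plane 0 = {v. v$1 = 0}"
  by (simp add: meridian_plane_def)

text \<open>Meridian directions are eigenvectors because the normal along the meridian is a unit
  vector staying in the \<open>yz\<close>-plane, so its derivative is tangent to the curve. Parallel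
  directions are eigenvectors because the normal turns along with the parallel. The clause on points
  of \<open>S \<inter> T\<close> serves to recognise any other curve in the plane as a
  reparametrisation of \<open>\<sigma>\<close>.\<close>

lemma profile_curve:
  fixes S :: "(real^3) set"
  assumes rev: "C2_surface_of_revolution S N" and p: "p \<in> S" "on_axis p" and Np: "N p = axis 3 1"
  obtains \<delta> T \<sigma> a a' where "\<delta> > 0" "open T" "p \<in> T" "\<sigma> 0 = p" "a 0 = 0" "isCont a' 0"
    "\<And>t. \<bar>t\<bar> < \<delta> \<Longrightarrow> \<sigma> t \<in> S \<and> \<sigma> t $ 1 = 0 \<and> \<sigma> t $ 2 = t"
    "\<And>t. \<bar>t\<bar> < \<delta> \<Longrightarrow> N (\<sigma> t) $ 1 = 0 \<and> N (\<sigma> t) $ 2 = a t \<and> N (\<sigma> t) $ 3 > 0"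
    "\<And>t. \<bar>t\<bar> < \<delta> \<Longrightarrow> isCont \<sigma> t"
    "\<And>t. \<bar>t\<bar> < \<delta> \<Longrightarrow> (a has_real_derivative a' t) (at t)"
    "\<And>q. q \<in> S \<inter> T \<Longrightarrow> q$1 = 0 \<Longrightarrow> \<bar>q$2\<bar> < \<delta> \<Longrightarrow> q = \<sigma> (q$2)"
    "\<And>t. \<bar>t\<bar> < \<delta> \<Longrightarrow> k_profile S N (\<sigma> t) = a' t"
    "\<And>t. \<bar>t\<bar> < \<delta> \<Longrightarrow> k_parallel S N (\<sigma> t) = (if t = 0 then a' 0 else a t / t)"
proof -
  have surf: "C2_regular_surface S" and normal: "unit_normal_field S N" and inv: "\<And>\<phi>. rotz \<phi> ` S = S"
    using rev unfolding C2_surface_of_revolution_def by auto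
  have normN: "\<And>q. q \<in> S \<Longrightarrow> norm (N q) = 1"
    and orthN: "\<And>q v. q \<in> S \<Longrightarrow> v \<in> tangent_space S q \<Longrightarrow> N q \<bullet> v = 0"
    using normal unfolding unit_normal_field_def by auto
  have rotS: "rotz \<phi> q \<in> S" if "q \<in> S" for \<phi> q using inv that by blast
  obtain T V \<zeta> \<zeta>' n n' where T: "open T" "p \<in> T" and V: "open V" and STV: "S \<inter> T = \<zeta> ` V"
    and P\<zeta>: "\<And>x. x \<in> V \<Longrightarrow> proj12 (\<zeta> x) = x"
    and d\<zeta>: "\<And>x. x \<in> V \<Longrightarrow> (\<zeta> has_derivative \<zeta>' x) (at x)"
    and P\<zeta>': "\<And>x w. x \<in> V \<Longrightarrow> proj12 (\<zeta>' x w) = w"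
    and N\<zeta>: "\<And>x. x \<in> V \<Longrightarrow> N (\<zeta> x) = n x"
    and n3: "\<And>x. x \<in> V \<Longrightarrow> n x $ 3 > 0"
    and dn: "\<And>x. x \<in> V \<Longrightarrow> (n has_derivative n' x) (at x)"
    and n'lim: "\<And>w. ((\<lambda>x. n' x w) \<longlongrightarrow> n' (proj12 p) w) (at (proj12 p))"
    by (rule graph_chart[OF surf normal p(1) Np]) blast
  have ST: "q \<in> S \<inter> T \<Longrightarrow> proj12 q \<in> V \<and> \<zeta> (proj12 q) = q" for q
    using P\<zeta> unfolding STV by auto
  have p0: "proj12 p = 0" using p(2) by (simp add: on_axis_def vec_eq_iff forall_2)
  have V0: "0 \<in> V" "\<zeta> 0 = p" using ST[of p] p T p0 by auto
  obtain \<delta> where \<delta>: "\<delta> > 0" "ball 0 \<delta> \<subseteq> V"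
    using V V0 open_contains_ball by blast
  define E :: "real^2" where "E = axis 2 1"
  have E: "E $ 1 = 0" "E $ 2 = 1" "norm E = 1" by (simp_all add: E_def axis_def norm_axis_1[unfolded axis_def])
  have tV: "t *\<^sub>R E \<in> V" if "\<bar>t\<bar> < \<delta>" for t using \<delta> that E by (auto intro!: subsetD[OF \<delta>(2)])
  define \<sigma> where "\<sigma> t = \<zeta> (t *\<^sub>R E)" for t
  define s where "s t = \<zeta>' (t *\<^sub>R E) E" for t
  define \<nu>' where "\<nu>' t = n' (t *\<^sub>R E) E" for t
  have \<sigma>ST: "\<sigma> t \<in> S" "\<sigma> t \<in> T" if "\<bar>t\<bar> < \<delta>" for t
    using STV tV[OF that] unfolding \<sigma>_def by auto
  have \<sigma>12: "\<sigma> t $ 1 = 0" "\<sigma> t $ 2 = t" if "\<bar>t\<bar> < \<delta>" for t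
    using P\<zeta>[OF tV[OF that]] E by (simp_all add: \<sigma>_def flip: proj12_nth)
  have \<sigma>0: "\<sigma> 0 = p" by (simp add: \<sigma>_def V0)
  have N\<sigma>: "N (\<sigma> t) = n (t *\<^sub>R E)" if "\<bar>t\<bar> < \<delta>" for t using N\<zeta>[OF tV[OF that]] by (simp add: \<sigma>_def)
  have line: "((\<lambda>t. t *\<^sub>R E) has_derivative (\<lambda>h. h *\<^sub>R E)) (at t)" for t
    by (auto intro!: derivative_eq_intros)
  have d\<sigma>: "(\<sigma> has_vector_derivative s t) (at t)" if "\<bar>t\<bar> < \<delta>" for t
    using has_derivative_compose[OF line d\<zeta>[OF tV[OF that]]]
      linear_scale[OF has_derivative_linear[OF d\<zeta>[OF tV[OF that]]]]
    by (simp add: has_vector_derivative_def \<sigma>_def[abs_def] s_def)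
  have d\<nu>: "((\<lambda>t. n (t *\<^sub>R E)) has_vector_derivative \<nu>' t) (at t)" if "\<bar>t\<bar> < \<delta>" for t
    using has_derivative_compose[OF line dn[OF tV[OF that]]]
      linear_scale[OF has_derivative_linear[OF dn[OF tV[OF that]]]]
    by (simp add: has_vector_derivative_def \<nu>'_def)
  have s12: "s t $ 1 = 0" "s t $ 2 = 1" if "\<bar>t\<bar> < \<delta>" for t
    using P\<zeta>'[OF tV[OF that], of E] E by (simp_all add: s_def flip: proj12_nth)
  have near: "\<forall>\<^sub>F h in nhds 0. \<bar>t + h\<bar> < \<delta>" if "\<bar>t\<bar> < \<delta>" for t
    using that unfolding eventually_nhds_metric
    by (intro exI[of _ "\<delta> - \<bar>t\<bar>"]) (auto simp: dist_real_def)
  have s_tan: "s t \<in> tangent_space S (\<sigma> t)" if t: "\<bar>t\<bar> < \<delta>" for t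
    unfolding s_def \<sigma>_def
    by (rule tangent_space_patch[OF V tV[OF t] _ d\<zeta>[OF tV[OF t]]]) (use STV in auto)

  \<comment> \<open>Both sides are unit normals at the rotated point, since rotations preserve
    tangent spaces. As \<open>q\<close> and its image lie in \<open>T\<close>, both point upward and
    so agree.\<close>
  have N_rot: "N (rotz \<phi> q) = rotz \<phi> (N q)" if q: "q \<in> S" "q \<in> T" "rotz \<phi> q \<in> T" for q \<phi>
  proof (rule unit_normal_unique)
    let ?x = "proj12 (rotz \<phi> q)"
    let ?w = "\<lambda>k. \<zeta>' ?x (axis k 1)"
    have x: "?x \<in> V" "\<zeta> ?x = rotz \<phi> q" using ST[of "rotz \<phi> q"] q rotS by auto
    have "?w k $ 1 = axis k 1 $ 1" "?w k $ 2 = axis k 1 $ 2" for k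
      using P\<zeta>'[OF x(1), of "axis k 1"] by (simp_all flip: proj12_nth)
    then show "?w 1 $ 1 = 1" "?w 1 $ 2 = 0" "?w 2 $ 1 = 0" "?w 2 $ 2 = 1"
      by (simp_all add: axis_def)
    have "?w k \<in> tangent_space S (\<zeta> ?x)" for k
      by (rule tangent_space_patch[OF V x(1) _ d\<zeta>[OF x(1)]]) (use STV in auto)
    then have w_tan: "?w k \<in> tangent_space S (rotz \<phi> q)" for k
      unfolding x(2) .
    then show "N (rotz \<phi> q) \<bullet> ?w 1 = 0" "N (rotz \<phi> q) \<bullet> ?w 2 = 0"
      using orthN rotS q by auto
    have "rotz (- \<phi>) (?w k) \<in> tangent_space S q" for k
      using tangent_space_rotz[OF inv w_tan, of "- \<phi>"] by (simp add: rotz_rotz)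
    then show "rotz \<phi> (N q) \<bullet> ?w 1 = 0" "rotz \<phi> (N q) \<bullet> ?w 2 = 0"
      unfolding inner_rotz using orthN q by auto
    show "norm (N (rotz \<phi> q)) = 1" "norm (rotz \<phi> (N q)) = 1"
      using normN q rotS by auto
    show "N (rotz \<phi> q) $ 3 > 0" using n3[OF x(1)] N\<zeta>[OF x(1)] x(2) by simp
    show "rotz \<phi> (N q) $ 3 > 0" using ST[of q] q n3 N\<zeta> by force
  qed
  \<comment> \<open>Near \<open>q\<close>, \<open>N\<close> coincides on \<open>S\<close> with
    \<open>n \<circ> proj12\<close>, which is differentiable in space.\<close>
  have dN: "\<exists>A. (N has_derivative A) (at q within S)" if q: "q \<in> S" "q \<in> T" for q
  proof -
    have x: "proj12 q \<in> V" "\<zeta> (proj12 q) = q" using ST q by auto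
    have "((\<lambda>q. n (proj12 q)) has_derivative (\<lambda>v. n' (proj12 q) (proj12 v))) (at q within S)"
      by (rule has_derivative_at_withinI, rule has_derivative_compose[OF bounded_linear_imp_has_derivative[OF bounded_linear_proj12]])
        (rule dn[OF x(1)])
    moreover have "\<forall>\<^sub>F q' in at q within S. n (proj12 q') = N q'"
    proof -
      have "\<forall>\<^sub>F q' in at q within S. q' \<in> T"
        using T(1) q(2) by (meson eventually_at_topological)
      moreover have "\<forall>\<^sub>F q' in at q within S. q' \<in> S"
        by (simp add: eventually_at_filter)
      ultimately show ?thesis
        by eventually_elim (use ST N\<zeta> in force)
    qed
    ultimately have "(N has_derivative (\<lambda>v. n' (proj12 q) (proj12 v))) (at q within S)"
      by (rule has_derivative_transform_eventually) (use x N\<zeta> q in force)+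
    then show ?thesis by blast
  qed
  have circle: "vector [- t, 0, 0] \<in> tangent_space S (\<sigma> t)" if t: "\<bar>t\<bar> < \<delta>" for t
    by (rule tangent_spaceI[of "\<lambda>\<phi>. rotz \<phi> (\<sigma> t)"])
      (use rotS \<sigma>ST[OF t] rotz_has_vector_derivative[of "\<sigma> t"] \<sigma>12[OF t] in auto)
  \<comment> \<open>Off the axis this is orthogonality to the parallel. At \<open>t = 0\<close> the
    parallel degenerates to a point, and the value of \<open>N p\<close> is used.\<close>
  have N1: "N (\<sigma> t) $ 1 = 0" if t: "\<bar>t\<bar> < \<delta>" for t
  proof (cases "t = 0")
    case True
    then show ?thesis using Np by (simp add: \<sigma>0 axis_def)
  next
    case False
    then show ?thesis using orthN[OF \<sigma>ST(1)[OF t] circle[OF t]] by (simp add: inner_3)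
  qed
  define a where "a t = n (t *\<^sub>R E) $ 2" for t
  define a' where "a' t = \<nu>' t $ 2" for t
  define b where "b t = n (t *\<^sub>R E) $ 3" for t
  have b: "b t > 0" if "\<bar>t\<bar> < \<delta>" for t using n3[OF tV[OF that]] by (simp add: b_def)
  have as: "a t + b t * s t $ 3 = 0" if t: "\<bar>t\<bar> < \<delta>" for t
    using orthN[OF \<sigma>ST(1)[OF t] s_tan[OF t]] N1[OF t] s12[OF t] by (simp add: inner_3 N\<sigma>[OF t] a_def b_def)
  \<comment> \<open>The derivative of a unit vector is orthogonal to it, and here it has no first
    component. In the \<open>yz\<close>-plane it is therefore a multiple of the tangent
    \<open>s t\<close>, and since \<open>s t $ 2 = 1\<close> the factor is its second
    component.\<close>
  have \<nu>'s: "\<nu>' t = a' t *\<^sub>R s t" if t: "\<bar>t\<bar> < \<delta>" for t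
  proof -
    have ev: "\<forall>\<^sub>F u in nhds t. \<bar>u\<bar> < \<delta>"
      using t unfolding eventually_nhds_metric
      by (intro exI[of _ "\<delta> - \<bar>t\<bar>"]) (auto simp: dist_real_def)
    have comp: "((\<lambda>t. n (t *\<^sub>R E) $ i) has_real_derivative \<nu>' t $ i) (at t)" for i
      using bounded_linear.has_vector_derivative[OF bounded_linear_vec_nth d\<nu>[OF t]]
      by (simp add: has_real_derivative_iff_has_vector_derivative)
    have "((\<lambda>t. n (t *\<^sub>R E) $ 1) has_real_derivative 0) (at t)"
      by (subst DERIV_cong_ev[OF refl _ refl, where g = "\<lambda>_. 0"])
        (use ev N1 N\<sigma> in \<open>auto elim!: eventually_mono\<close>)
    then have 1: "\<nu>' t $ 1 = 0" using comp[of 1] DERIV_unique by blast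
    have nn: "n (u *\<^sub>R E) \<bullet> n (u *\<^sub>R E) = 1" if "\<bar>u\<bar> < \<delta>" for u
      using normN[OF \<sigma>ST(1)[OF that]] by (simp add: N\<sigma>[OF that] norm_eq_1)
    have "((\<lambda>t. n (t *\<^sub>R E) \<bullet> n (t *\<^sub>R E)) has_real_derivative 0) (at t)"
      by (subst DERIV_cong_ev[OF refl _ refl, where g = "\<lambda>_. 1"])
        (use ev nn in \<open>auto elim!: eventually_mono\<close>)
    moreover have "((\<lambda>t. n (t *\<^sub>R E) \<bullet> n (t *\<^sub>R E)) has_real_derivative 2 * (n (t *\<^sub>R E) \<bullet> \<nu>' t)) (at t)"
      unfolding inner_3 by (rule derivative_eq_intros comp refl)+ simp
    ultimately have "n (t *\<^sub>R E) \<bullet> \<nu>' t = 0" using DERIV_unique by fastforce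
    then have "a t * a' t + b t * \<nu>' t $ 3 = 0"
      using 1 by (simp add: inner_3 a_def a'_def b_def)
    moreover have "a t = - b t * s t $ 3" using as[OF t] by simp
    ultimately have "b t * (\<nu>' t $ 3 - a' t * s t $ 3) = 0" by (simp add: algebra_simps)
    then have "\<nu>' t $ 3 = a' t * s t $ 3" using b[OF t] by simp
    then show ?thesis using 1 s12[OF t] by (simp add: vec_eq_iff forall_3 a'_def)
  qed
  have da: "(a has_real_derivative a' t) (at t)" if "\<bar>t\<bar> < \<delta>" for t
    using bounded_linear.has_vector_derivative[OF bounded_linear_vec_nth d\<nu>[OF that], of 2]
    by (simp add: has_real_derivative_iff_has_vector_derivative a_def[abs_def] a'_def)
  have "n 0 = axis 3 1" using N\<sigma>[of 0] \<delta>(1) Np \<sigma>0 by simp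
  then have a0: "a 0 = 0" by (simp add: a_def axis_def)
  have conta': "isCont a' 0"
  proof -
    have "filterlim (\<lambda>t. t *\<^sub>R E) (at 0) (at 0)"
      using E(3) by (auto simp: filterlim_at eventually_at_filter intro!: tendsto_eq_intros)
    then have "((\<lambda>t. n' (t *\<^sub>R E) E) \<longlongrightarrow> n' 0 E) (at 0)"
      using n'lim[of E] unfolding p0 by (rule filterlim_compose[rotated])
    then have "(a' \<longlongrightarrow> n' 0 E $ 2) (at 0)"
      unfolding a'_def \<nu>'_def by (rule tendsto_vec_nth)
    then show ?thesis by (simp add: isCont_def a'_def \<nu>'_def)
  qed

  \<comment> \<open>Rotated meridians are included for the sake of \<open>t = 0\<close>: every
    rotation fixes \<open>p\<close>, and the rotated vectors \<open>s 0\<close> give all horizontal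
    unit vectors.\<close>
  have A_profile: "A (rotz \<phi> (s t)) = a' t *\<^sub>R rotz \<phi> (s t)"
    if t: "\<bar>t\<bar> < \<delta>" and \<phi>: "rotz \<phi> (\<sigma> t) \<in> T" and A: "(N has_derivative A) (at (rotz \<phi> (\<sigma> t)) within S)"
    for t \<phi> A
  proof (rule dN_along_curve[OF A, where c = "\<lambda>h. rotz \<phi> (\<sigma> (t + h))"])
    have shift: "((\<lambda>h. \<sigma> (t + h)) has_vector_derivative s t) (at 0)"
      using d\<sigma>[OF t] by (rule has_vector_derivative_translate)
    show c': "((\<lambda>h. rotz \<phi> (\<sigma> (t + h))) has_vector_derivative rotz \<phi> (s t)) (at 0)"
      by (rule bounded_linear.has_vector_derivative[OF bounded_linear_rotz shift])
    show "\<forall>\<^sub>F h in nhds 0. rotz \<phi> (\<sigma> (t + h)) \<in> S"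
      using near[OF t] by eventually_elim (use rotS \<sigma>ST in auto)
    have "((\<lambda>h. n ((t + h) *\<^sub>R E)) has_vector_derivative \<nu>' t) (at 0)"
      using d\<nu>[OF t] by (rule has_vector_derivative_translate)
    then have "((\<lambda>h. rotz \<phi> (n ((t + h) *\<^sub>R E))) has_vector_derivative rotz \<phi> (\<nu>' t)) (at 0)"
      by (rule bounded_linear.has_vector_derivative[OF bounded_linear_rotz])
    moreover have "\<forall>\<^sub>F h in nhds 0. rotz \<phi> (n ((t + h) *\<^sub>R E)) = N (rotz \<phi> (\<sigma> (t + h)))"
    proof -
      have "\<forall>\<^sub>F h in nhds 0. rotz \<phi> (\<sigma> (t + h)) \<in> T"
        by (rule isCont_eventually_in_open[OF has_vector_derivative_continuous[OF c'] T(1)])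
          (simp add: \<phi>)
      then show ?thesis using near[OF t]
        by eventually_elim (use N_rot \<sigma>ST N\<sigma> in auto)
    qed
    ultimately have "((\<lambda>h. N (rotz \<phi> (\<sigma> (t + h)))) has_vector_derivative rotz \<phi> (\<nu>' t)) (at 0)"
      by (rule has_vector_derivative_transform_nhds)
    then show "((\<lambda>h. N (rotz \<phi> (\<sigma> (t + h)))) has_vector_derivative a' t *\<^sub>R rotz \<phi> (s t)) (at 0)"
      by (simp add: \<nu>'s[OF t] rotz_scaleR)
  qed simp
  \<comment> \<open>Under rotation the point moves with velocity \<open>vector [- t, 0, 0]\<close>
    and its normal with \<open>vector [- a t, 0, 0]\<close>; the ratio is the eigenvalue.\<close>
  have A_parallel: "A (axis 1 1) = (a t / t) *\<^sub>R axis 1 1"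
    if t: "\<bar>t\<bar> < \<delta>" "t \<noteq> 0" and A: "(N has_derivative A) (at (\<sigma> t) within S)" for t A
  proof -
    have "A (vector [- t, 0, 0]) = vector [- a t, 0, 0]"
    proof (rule dN_along_curve[OF A, where c = "\<lambda>\<phi>. rotz \<phi> (\<sigma> t)"])
      show "\<forall>\<^sub>F \<phi> in nhds 0. rotz \<phi> (\<sigma> t) \<in> S" using rotS \<sigma>ST t by simp
      show "((\<lambda>\<phi>. rotz \<phi> (\<sigma> t)) has_vector_derivative vector [- t, 0, 0]) (at 0)"
        using rotz_has_vector_derivative[of "\<sigma> t"] \<sigma>12[OF t(1)] by simp
      have "((\<lambda>\<phi>. rotz \<phi> (N (\<sigma> t))) has_vector_derivative vector [- a t, 0, 0]) (at 0)"
        using rotz_has_vector_derivative[of "N (\<sigma> t)"] N1[OF t(1)] N\<sigma>[OF t(1)] by (simp add: a_def)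
      moreover have "\<forall>\<^sub>F \<phi> in nhds 0. rotz \<phi> (N (\<sigma> t)) = N (rotz \<phi> (\<sigma> t))"
      proof -
        have "\<forall>\<^sub>F \<phi> in nhds 0. rotz \<phi> (\<sigma> t) \<in> T"
          by (rule isCont_eventually_in_open[OF isCont_rotz T(1)]) (simp add: \<sigma>ST[OF t(1)])
        then show ?thesis
          by eventually_elim (use N_rot \<sigma>ST[OF t(1)] in auto)
      qed
      ultimately show "((\<lambda>\<phi>. N (rotz \<phi> (\<sigma> t))) has_vector_derivative vector [- a t, 0, 0]) (at 0)"
        by (rule has_vector_derivative_transform_nhds)
    qed simp
    moreover have "vector [- t, 0, 0] = (- t) *\<^sub>R (axis 1 1 :: real^3)" "vector [- a t, 0, 0] = (- a t) *\<^sub>R (axis 1 1 :: real^3)"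
      by (simp_all add: vec_eq_iff forall_3 axis_def)
    ultimately have "(- t) *\<^sub>R A (axis 1 1) = (- a t) *\<^sub>R axis 1 1"
      using linear_scale[OF has_derivative_linear[OF A]] by metis
    then show ?thesis using t(2) by (simp add: vec_eq_iff field_simps)
  qed

  \<comment> \<open>Off the axis the meridian plane through a point is unique, here the
    \<open>yz\<close>-plane, so \<open>\<phi>\<close> is a multiple of \<open>pi\<close>.\<close>
  have merid: "sin \<phi> = 0" if t: "\<bar>t\<bar> < \<delta>" "t \<noteq> 0" and q: "\<sigma> t \<in> meridian_plane \<phi>" for t \<phi>
  proof -
    obtain v where v: "v$1 = 0" "\<sigma> t = rotz \<phi> v" using q unfolding meridian_plane_def by auto
    then have "- sin \<phi> * v$2 = 0" "cos \<phi> * v$2 = t" using \<sigma>12[OF t(1)] by auto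
    then show ?thesis using t(2) by auto
  qed
  have s0: "s 0 = axis 2 1"
    using s12[of 0] as[of 0] b[of 0] a0 \<delta>(1) by (simp add: vec_eq_iff forall_3 axis_def)

  \<comment> \<open>The values of the two curvatures\<close>
  have profile: "k_profile S N (\<sigma> t) = a' t" if t: "\<bar>t\<bar> < \<delta>" for t
    unfolding k_profile_def
  proof (rule the_equality)
    obtain A where A: "(N has_derivative A) (at (\<sigma> t) within S)" using dN \<sigma>ST[OF t] by blast
    have "A (s t) = a' t *\<^sub>R s t" using A_profile[OF t, of 0 A] A \<sigma>ST[OF t] by simp
    moreover have "s t \<noteq> 0" using s12[OF t] by (metis zero_index zero_neq_one)
    ultimately have "principal_curvature S N (\<sigma> t) (s t) (a' t)"
      unfolding principal_curvature_def using s_tan[OF t] A by blast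
    then show "\<exists>\<phi>. \<sigma> t \<in> meridian_plane \<phi> \<and> (\<exists>v\<in>meridian_plane \<phi>. principal_curvature S N (\<sigma> t) v (a' t))"
      using \<sigma>12[OF t] s12[OF t] by (intro exI[of _ 0]) (auto simp: meridian_plane_0)
  next
    fix k assume "\<exists>\<phi>. \<sigma> t \<in> meridian_plane \<phi> \<and> (\<exists>v\<in>meridian_plane \<phi>. principal_curvature S N (\<sigma> t) v k)"
    then obtain \<phi> v A where \<phi>: "\<sigma> t \<in> meridian_plane \<phi>" and v: "v \<in> meridian_plane \<phi>" "v \<in> tangent_space S (\<sigma> t)" "v \<noteq> 0"
      and A: "(N has_derivative A) (at (\<sigma> t) within S)" and Av: "A v = k *\<^sub>R v"
      unfolding principal_curvature_def by blast
    obtain u where u: "u$1 = 0" "v = rotz \<phi> u" using v unfolding meridian_plane_def by auto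
    have orth: "a t * v$2 + b t * v$3 = 0"
      using orthN[OF \<sigma>ST(1)[OF t] v(2)] N1[OF t] by (simp add: inner_3 N\<sigma>[OF t] a_def b_def)
    \<comment> \<open>Any admissible vector is a multiple of \<open>s t\<close>, turned by a
      rotation that fixes the point: by \<open>\<phi>\<close> on the axis, by 0 off it.
      \<open>A_profile\<close> then applies.\<close>
    obtain \<psi> c where vs: "v = c *\<^sub>R rotz \<psi> (s t)" and \<psi>: "rotz \<psi> (\<sigma> t) = \<sigma> t"
    proof (cases "t = 0")
      case True
      have "v = (u$2) *\<^sub>R rotz \<phi> (s t)"
        using orth a0 b[OF t] u True by (simp add: vec_eq_iff forall_3 s0 axis_def)
      then show ?thesis using that rotz_on_axis[OF p(2)] True \<sigma>0 by blast
    next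
      case False
      have "v$1 = 0" using u merid[OF t False \<phi>] by simp
      moreover have "b t * (v$3 - v$2 * s t $ 3) = 0"
        using orth as[OF t] by (simp add: algebra_simps) algebra
      ultimately have "v = (v$2) *\<^sub>R rotz 0 (s t)"
        using b[OF t] s12[OF t] by (simp add: vec_eq_iff forall_3)
      then show ?thesis using that rotz_0 by blast
    qed
    have "A (rotz \<psi> (s t)) = a' t *\<^sub>R rotz \<psi> (s t)"
      using A_profile[OF t, of \<psi> A] A \<psi> \<sigma>ST[OF t] by simp
    then have "A v = a' t *\<^sub>R v"
      unfolding vs linear_scale[OF has_derivative_linear[OF A]] by simp
    then show "k = a' t" using Av v(3) by simp
  qed
  have parallel: "k_parallel S N (\<sigma> t) = a t / t" if t: "\<bar>t\<bar> < \<delta>" "t \<noteq> 0" for t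
    unfolding k_parallel_def
  proof (rule the_equality)
    obtain A where A: "(N has_derivative A) (at (\<sigma> t) within S)" using dN \<sigma>ST[OF t(1)] by blast
    have "axis 1 1 \<in> tangent_space S (\<sigma> t)"
    \<comment> \<open>The factor \<open>- 1 / t\<close> rescales the velocity
      \<open>vector [- t, 0, 0]\<close> of the parallel to \<open>axis 1 1\<close>.\<close>
    proof (rule tangent_spaceI[of "\<lambda>\<phi>. rotz (- \<phi> / t) (\<sigma> t)"])
      show "((\<lambda>\<phi>. rotz (- \<phi> / t) (\<sigma> t)) has_vector_derivative axis 1 1) (at 0)"
      proof -
        have "((\<lambda>\<phi>. - \<phi> / t) has_vector_derivative - (1 / t)) (at 0)"
          by (rule derivative_eq_intros refl | simp)+
        moreover have "- (1 / t) *\<^sub>R vector [- t, 0, 0] = (axis 1 1 :: real^3)"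
          using t(2) by (simp add: vec_eq_iff forall_3 axis_def)
        ultimately show ?thesis
          using vector_diff_chain_at[of "\<lambda>\<phi>. - \<phi> / t" "- (1 / t)" 0 "\<lambda>\<phi>. rotz \<phi> (\<sigma> t)" "vector [- t, 0, 0]"]
            rotz_has_vector_derivative[of "\<sigma> t"] \<sigma>12[OF t(1)] by (simp add: o_def)
      qed
    qed (use rotS \<sigma>ST[OF t(1)] in auto)
    then have "principal_curvature S N (\<sigma> t) (axis 1 1) (a t / t)"
      unfolding principal_curvature_def using A_parallel[OF t A] A by (auto simp: axis_eq_0_iff)
    then show "\<exists>\<phi>. \<sigma> t \<in> meridian_plane \<phi> \<and> principal_curvature S N (\<sigma> t) (rotz \<phi> (axis 1 1)) (a t / t)"
      using \<sigma>12[OF t(1)] by (intro exI[of _ 0]) (auto simp: meridian_plane_0)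
  next
    fix k assume "\<exists>\<phi>. \<sigma> t \<in> meridian_plane \<phi> \<and> principal_curvature S N (\<sigma> t) (rotz \<phi> (axis 1 1)) k"
    then obtain \<phi> A where \<phi>: "\<sigma> t \<in> meridian_plane \<phi>"
      and A: "(N has_derivative A) (at (\<sigma> t) within S)" and Av: "A (rotz \<phi> (axis 1 1)) = k *\<^sub>R rotz \<phi> (axis 1 1)"
      and ne: "rotz \<phi> (axis 1 1) \<noteq> 0"
      unfolding principal_curvature_def by blast
    have "rotz \<phi> (axis 1 1) = cos \<phi> *\<^sub>R axis 1 1"
      using merid[OF t \<phi>] by (simp add: vec_eq_iff forall_3 axis_def)
    then have "A (rotz \<phi> (axis 1 1)) = (a t / t) *\<^sub>R rotz \<phi> (axis 1 1)"
      using linear_scale[OF has_derivative_linear[OF A]] A_parallel[OF t A] by simp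
    then show "k = a t / t" using Av ne by simp
  qed
  \<comment> \<open>On the axis a parallel direction is a meridian direction turned by a right
    angle, so \<open>A_profile\<close> also gives the parallel curvature there. Below,
    \<open>0 - pi / 2\<close> is this angle for \<open>\<phi> = 0\<close>.\<close>
  have turn: "rotz \<phi> (axis 1 1) = rotz (\<phi> - pi / 2) (s 0)" for \<phi>
    by (simp add: s0 vec_eq_iff forall_3 axis_def sin_diff cos_diff)
  have parallel0: "k_parallel S N (\<sigma> 0) = a' 0"
    unfolding k_parallel_def
  proof (rule the_equality)
    obtain A where A: "(N has_derivative A) (at (\<sigma> 0) within S)" using dN[of p] p T \<sigma>0 by auto
    have "rotz (0 - pi / 2) (s 0) \<in> tangent_space S (rotz (0 - pi / 2) (\<sigma> 0))"
      using tangent_space_rotz[OF inv s_tan] \<delta>(1) by simp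
    moreover have "A (rotz (0 - pi / 2) (s 0)) = a' 0 *\<^sub>R rotz (0 - pi / 2) (s 0)"
      using A_profile[of 0 "0 - pi / 2" A] A T \<delta>(1) rotz_on_axis[OF p(2)] by (simp add: \<sigma>0)
    moreover have "rotz (0 - pi / 2) (s 0) \<noteq> 0"
      using norm_rotz[of "0 - pi / 2" "s 0"] by (auto simp only: s0 norm_axis_1 norm_zero)
    moreover have "rotz (0 - pi / 2) (\<sigma> 0) = \<sigma> 0"
      using rotz_on_axis[OF p(2)] by (simp only: \<sigma>0)
    ultimately have "principal_curvature S N (\<sigma> 0) (rotz 0 (axis 1 1)) (a' 0)"
      unfolding principal_curvature_def turn using A by auto
    then show "\<exists>\<phi>. \<sigma> 0 \<in> meridian_plane \<phi> \<and> principal_curvature S N (\<sigma> 0) (rotz \<phi> (axis 1 1)) (a' 0)"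
      using \<sigma>12[of 0] \<delta>(1) by (intro exI[of _ 0]) (auto simp: meridian_plane_0)
  next
    fix k assume "\<exists>\<phi>. \<sigma> 0 \<in> meridian_plane \<phi> \<and> principal_curvature S N (\<sigma> 0) (rotz \<phi> (axis 1 1)) k"
    then obtain \<phi> A where A: "(N has_derivative A) (at (\<sigma> 0) within S)"
      and Av: "A (rotz (\<phi> - pi / 2) (s 0)) = k *\<^sub>R rotz (\<phi> - pi / 2) (s 0)"
      and ne: "rotz (\<phi> - pi / 2) (s 0) \<noteq> 0"
      unfolding principal_curvature_def turn by blast
    have "A (rotz (\<phi> - pi / 2) (s 0)) = a' 0 *\<^sub>R rotz (\<phi> - pi / 2) (s 0)"
      using A_profile[of 0 "\<phi> - pi / 2" A] A T \<delta>(1) rotz_on_axis[OF p(2)] by (simp add: \<sigma>0)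
    then show "k = a' 0" using Av ne by simp
  qed
  show ?thesis
  proof (rule that[OF \<delta>(1) T \<sigma>0 a0 conta' _ _ _ da _ profile])
    show "isCont \<sigma> t" if "\<bar>t\<bar> < \<delta>" for t using has_vector_derivative_continuous[OF d\<sigma>[OF that]] .
    show "q = \<sigma> (q$2)" if q: "q \<in> S \<inter> T" "q$1 = 0" "\<bar>q$2\<bar> < \<delta>" for q
    proof -
      have "proj12 q = (q$2) *\<^sub>R E" using q(2) E by (simp add: vec_eq_iff forall_2)
      then show ?thesis using ST[OF q(1)] by (simp add: \<sigma>_def)
    qed
    show "k_parallel S N (\<sigma> t) = (if t = 0 then a' 0 else a t / t)" if "\<bar>t\<bar> < \<delta>" for t
      using parallel[OF that] parallel0 by auto
  qed (use \<sigma>ST \<sigma>12 N1 N\<sigma> n3 tV in \<open>auto simp: a_def\<close>)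
qed

section \<open>The Gauss angle as parameter\<close>

text \<open>By continuity at 0 the derivative keeps its sign near 0, so \<open>f\<close> is strictly
  monotone on a closed interval and has a continuous inverse. Nonvanishing of \<open>f'\<close> on
  that interval is kept for differentiating an inverse later.\<close>

lemma inverse_interval_of_DERIV_nonzero:
  fixes f f' :: "real \<Rightarrow> real"
  assumes \<delta>: "\<delta> > 0" and f: "\<And>t. \<bar>t\<bar> < \<delta> \<Longrightarrow> (f has_real_derivative f' t) (at t)"
    and f0: "f 0 = 0" and cont: "isCont f' 0" and ne: "f' 0 \<noteq> 0"
  obtains d \<eta> g where "0 < d" "d < \<delta>" "\<And>t. \<bar>t\<bar> \<le> d \<Longrightarrow> f' t \<noteq> 0" "0 < \<eta>" "g 0 = 0"
    "continuous_on {-\<eta>..\<eta>} g" "\<And>s. \<bar>s\<bar> \<le> \<eta> \<Longrightarrow> \<bar>g s\<bar> \<le> d \<and> f (g s) = s"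
proof -
  \<comment> \<open>Multiplying by \<open>f' 0\<close> makes \<open>k * f\<close> increasing for
    either sign of the derivative.\<close>
  define k where "k = f' 0"
  have kk: "k * f' 0 > 0" using ne by (auto simp: k_def zero_less_mult_iff)
  have "\<forall>\<^sub>F t in nhds 0. k * f' t \<in> {0<..}"
    by (rule isCont_eventually_in_open) (use cont kk in \<open>auto intro!: continuous_intros\<close>)
  then obtain d0 where d0: "d0 > 0" "\<And>t. \<bar>t\<bar> < d0 \<Longrightarrow> k * f' t > 0"
    unfolding eventually_nhds_metric by (auto simp: dist_real_def)
  define d where "d = min d0 \<delta> / 2"
  have d: "0 < d" "d < \<delta>" "d < d0" using d0 \<delta> by (auto simp: d_def)
  have pos: "k * f' t > 0" if "\<bar>t\<bar> \<le> d" for t using d0(2)[of t] that d by simp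
  have df: "((\<lambda>t. k * f t) has_real_derivative k * f' t) (at t)" if "\<bar>t\<bar> \<le> d" for t
    using f[of t] that d by (auto intro!: derivative_eq_intros)
  have contf: "continuous_on {-d..d} f"
    by (intro continuous_at_imp_continuous_on ballI DERIV_isCont[OF f]) (use d in auto)
  have mono: "k * f x < k * f y" if "-d \<le> x" "x < y" "y \<le> d" for x y
  proof (rule DERIV_pos_imp_increasing[OF that(2)])
    fix z assume "x \<le> z" "z \<le> y"
    then have "\<bar>z\<bar> \<le> d" using that by auto
    then show "\<exists>D. ((\<lambda>t. k * f t) has_real_derivative D) (at z) \<and> D > 0" using df pos by blast
  qed
  have inj: "inj_on f {-d..d}"
  proof (rule inj_onI)
    fix x y assume "x \<in> {-d..d}" "y \<in> {-d..d}" "f x = f y"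
    then show "x = y" using mono[of x y] mono[of y x] by (cases x y rule: linorder_cases) auto
  qed
  define g where "g = inv_into {-d..d} f"
  \<comment> \<open>Chosen so that \<open>\<bar>s\<bar> \<le> \<eta>\<close> puts
    \<open>k * s\<close> between the end values of \<open>k * f\<close>, where the intermediate
    value theorem yields a preimage.\<close>
  define \<eta> where "\<eta> = min (k * f d) (- (k * f (- d))) / \<bar>k\<bar>"
  have k0: "k \<noteq> 0" using ne by (simp add: k_def)
  have ends: "k * f d > 0" "k * f (-d) < 0"
    using mono[of 0 d] mono[of "-d" 0] d f0 by auto
  have \<eta>: "\<eta> > 0" using ends k0 by (simp add: \<eta>_def)
  have onto: "s \<in> f ` {-d..d}" if s: "\<bar>s\<bar> \<le> \<eta>" for s
  proof -
    have "\<bar>k * s\<bar> \<le> \<bar>k\<bar> * \<eta>" using s by (simp add: abs_mult mult_left_mono)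
    also have "\<dots> = min (k * f d) (- (k * f (- d)))" using k0 by (simp add: \<eta>_def)
    finally have "k * f (-d) \<le> k * s" "k * s \<le> k * f d" by auto
    moreover have "continuous_on {-d..d} (\<lambda>t. k * f t)" by (intro continuous_intros contf)
    ultimately obtain x where "-d \<le> x" "x \<le> d" "k * f x = k * s"
      using IVT'[of "\<lambda>t. k * f t" "-d" "k * s" d] d by auto
    then show ?thesis using k0 by auto
  qed
  have "continuous_on (f ` {-d..d}) g"
    by (rule continuous_on_inv[OF contf]) (auto simp: g_def inv_into_f_f[OF inj])
  then have "continuous_on {-\<eta>..\<eta>} g"
    by (rule continuous_on_subset) (use onto in auto)
  moreover have "\<bar>g s\<bar> \<le> d \<and> f (g s) = s" if "\<bar>s\<bar> \<le> \<eta>" for s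
    using inv_into_into[OF onto[OF that]] f_inv_into_f[OF onto[OF that]] by (auto simp: g_def)
  moreover have "g 0 = 0" using inv_into_f_f[OF inj, of 0] d f0 by (simp add: g_def)
  ultimately show ?thesis using that[OF d(1,2) _ \<eta>] pos by force
qed

text \<open>The hypotheses of the analytic part for \<open>r1\<close> and \<open>r2\<close>. As the
  parametrisation is a choice, existence is shown first; after that only the defining properties of
  the chosen curve are used, which force it onto \<open>\<sigma>\<close> near
  \<open>p\<close>.\<close>

lemma radii_near_umbilic:
  assumes rev: "C2_surface_of_revolution S N" and iso: "isolated_umbilic S N p"
    and axis: "on_axis p" and angle: "has_gauss_angle N p 0" and convex: "strictly_convex_at S N p"
  shows DERIV_r1: "\<forall>\<^sub>F x in at_right 0. (r1 S N p has_real_derivative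
            (r2 S N p x - r1 S N p x) * cos x / sin x) (at x)"
    and r1_tendsto: "(r1 S N p \<longlongrightarrow> radius_parallel S N p) (at_right 0)"
    and r1_neq_r2: "\<forall>\<^sub>F x in at_right 0. r1 S N p x \<noteq> r2 S N p x"
proof -
  have pS: "p \<in> S" using iso by (simp add: isolated_umbilic_def umbilic_def)
  have Np: "N p = axis 3 1"
    using angle by (simp add: has_gauss_angle_def vec_eq_iff forall_3 axis_def)
  have normN: "\<And>q. q \<in> S \<Longrightarrow> norm (N q) = 1"
    using rev unfolding C2_surface_of_revolution_def unit_normal_field_def by auto
  obtain \<delta> T \<sigma> a a' where \<delta>: "\<delta> > 0" and T: "open T" "p \<in> T" and \<sigma>0: "\<sigma> 0 = p" and a0: "a 0 = 0"
    and conta': "isCont a' 0"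
    and \<sigma>: "\<And>t. \<bar>t\<bar> < \<delta> \<Longrightarrow> \<sigma> t \<in> S \<and> \<sigma> t $ 1 = 0 \<and> \<sigma> t $ 2 = t"
    and N\<sigma>: "\<And>t. \<bar>t\<bar> < \<delta> \<Longrightarrow> N (\<sigma> t) $ 1 = 0 \<and> N (\<sigma> t) $ 2 = a t \<and> N (\<sigma> t) $ 3 > 0"
    and cont\<sigma>: "\<And>t. \<bar>t\<bar> < \<delta> \<Longrightarrow> isCont \<sigma> t"
    and da: "\<And>t. \<bar>t\<bar> < \<delta> \<Longrightarrow> (a has_real_derivative a' t) (at t)"
    and uniq: "\<And>q. q \<in> S \<inter> T \<Longrightarrow> q$1 = 0 \<Longrightarrow> \<bar>q$2\<bar> < \<delta> \<Longrightarrow> q = \<sigma> (q$2)"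
    and k2: "\<And>t. \<bar>t\<bar> < \<delta> \<Longrightarrow> k_profile S N (\<sigma> t) = a' t"
    and k1: "\<And>t. \<bar>t\<bar> < \<delta> \<Longrightarrow> k_parallel S N (\<sigma> t) = (if t = 0 then a' 0 else a t / t)"
    by (rule profile_curve[OF rev pS axis Np]) blast
  have a'0: "a' 0 \<noteq> 0"
    using convex k1[of 0] k2[of 0] \<delta> by (auto simp: strictly_convex_at_def gauss_curvature_def \<sigma>0)
  obtain d \<eta> g where d: "0 < d" "d < \<delta>" and a'_ne: "\<And>t. \<bar>t\<bar> \<le> d \<Longrightarrow> a' t \<noteq> 0" and \<eta>: "0 < \<eta>"
    and g0: "g 0 = 0" and contg: "continuous_on {-\<eta>..\<eta>} g"
    and g: "\<And>s. \<bar>s\<bar> \<le> \<eta> \<Longrightarrow> \<bar>g s\<bar> \<le> d \<and> a (g s) = s"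
    by (rule inverse_interval_of_DERIV_nonzero[OF \<delta> da a0 conta' a'0]) blast+

  \<comment> \<open>Along \<open>\<sigma>\<close> the second component \<open>a\<close> of the
    normal is the sine of the Gauss angle, so the parameter of angle \<open>x\<close> is
    \<open>g (sin x)\<close>.\<close>
  have "is_gauss_param S N p (\<lambda>x. \<sigma> (g (sin x)))"
    unfolding is_gauss_param_def
  proof (intro conjI exI ballI)
    \<comment> \<open>The bound \<open>\<eta>\<close> keeps \<open>sin x\<close> in the domain of
      \<open>g\<close>. The bound 1, below \<open>pi/2\<close>, keeps \<open>cos x\<close> positive,
      which fixes the sign of the third component of the normal.\<close>
    let ?e = "min \<eta> 1"
    have e: "\<bar>sin x\<bar> \<le> \<eta>" "\<bar>g (sin x)\<bar> < \<delta>" if "x \<in> {-?e<..<?e}" for x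
    proof -
      show "\<bar>sin x\<bar> \<le> \<eta>" using abs_sin_x_le_abs_x[of x] that by auto
      then show "\<bar>g (sin x)\<bar> < \<delta>" using g[of "sin x"] d by auto
    qed
    show "\<sigma> (g (sin 0)) = p" by (simp add: g0 \<sigma>0)
    show "?e > 0" using \<eta> by simp
    have contgs: "continuous_on {-?e<..<?e} (\<lambda>x. g (sin x))" 
    proof (rule continuous_on_compose2[OF contg])
      show "sin ` {-?e<..<?e} \<subseteq> {-\<eta>..\<eta>}" using e(1) by (force simp: abs_le_iff)
    qed (intro continuous_intros)
    have cont\<sigma>': "continuous_on {-\<delta><..<\<delta>} \<sigma>"
      by (intro continuous_at_imp_continuous_on ballI cont\<sigma>) auto
    show "continuous_on {-?e<..<?e} (\<lambda>x. \<sigma> (g (sin x)))"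
    proof (rule continuous_on_compose2[OF cont\<sigma>' contgs])
      show "(\<lambda>x. g (sin x)) ` {-?e<..<?e} \<subseteq> {-\<delta><..<\<delta>}" using e(2) by (force simp: abs_less_iff)
    qed
    fix x assume x: "x \<in> {-?e<..<?e}"
    let ?q = "\<sigma> (g (sin x))"
    show S: "?q \<in> S" using \<sigma> e[OF x] by blast
    have "cos x > 0" using x pi_gt3 by (intro cos_gt_zero_pi) auto
    moreover have "(N ?q $ 3)\<^sup>2 = (cos x)\<^sup>2"
      using normN[OF S] N\<sigma>[OF e(2)[OF x]] g[OF e(1)[OF x]] sin_cos_squared_add[of x]
      by (simp add: norm_eq_1 inner_3 power2_eq_square)
    ultimately have "N ?q $ 3 = cos x"
      using N\<sigma>[OF e(2)[OF x]] by simp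
    then show "has_gauss_angle N ?q x"
      using N\<sigma>[OF e(2)[OF x]] g[OF e(1)[OF x]] \<sigma>[OF e(2)[OF x]]
      by (simp add: has_gauss_angle_def meridian_plane_0 vec_eq_iff forall_3)
  qed
  then have param: "is_gauss_param S N p (gauss_param S N p)"
    unfolding gauss_param_def by (metis someI)
  define c where "c = gauss_param S N p"
  obtain e where e: "e > 0" and contc: "continuous_on {-e<..<e} c" and c0: "c 0 = p"
    and c: "\<And>x. \<bar>x\<bar> < e \<Longrightarrow> c x \<in> S \<and> has_gauss_angle N (c x) x"
    using param unfolding is_gauss_param_def c_def[symmetric] by (auto simp: abs_less_iff)
  define \<rho> where "\<rho> x = c x $ 2" for x
  have contc': "isCont c x" if "\<bar>x\<bar> < e" for x
    using contc that by (simp add: continuous_on_eq_continuous_at abs_less_iff)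
  have cont\<rho>: "isCont \<rho> x" if "\<bar>x\<bar> < e" for x
    unfolding \<rho>_def by (intro continuous_intros contc'[OF that])
  have \<rho>0: "\<rho> 0 = 0" using axis c0 by (simp add: \<rho>_def on_axis_def)
  \<comment> \<open>Inside \<open>T\<close> the curve must run along \<open>\<sigma>\<close>;
    \<open>\<bar>\<rho> x\<bar> < d\<close> keeps \<open>a' (\<rho> x)\<close> nonzero; below
    \<open>pi/2\<close> the arcsine undoes the sine.\<close>
  obtain e' where e': "0 < e'" "e' < e" "e' < pi/2"
    and near: "\<And>x. \<bar>x\<bar> < e' \<Longrightarrow> c x \<in> T \<and> \<bar>\<rho> x\<bar> < d"
  proof -
    have "\<forall>\<^sub>F x in nhds 0. c x \<in> T"
      using isCont_eventually_in_open[OF contc' T(1)] e T c0 by simp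
    moreover have "\<forall>\<^sub>F x in nhds 0. \<rho> x \<in> {-d<..<d}"
      using isCont_eventually_in_open[OF cont\<rho>, of 0 "{-d<..<d}"] e d \<rho>0 by simp
    ultimately have "\<forall>\<^sub>F x in nhds 0. c x \<in> T \<and> \<rho> x \<in> {-d<..<d}"
      by eventually_elim auto
    then obtain r where r: "r > 0" "\<And>x. \<bar>x\<bar> < r \<Longrightarrow> c x \<in> T \<and> \<rho> x \<in> {-d<..<d}"
      unfolding eventually_nhds_metric by (auto simp: dist_real_def)
    show ?thesis
    proof (rule that[of "min r (min e 1) / 2"])
      show "c x \<in> T \<and> \<bar>\<rho> x\<bar> < d" if "\<bar>x\<bar> < min r (min e 1) / 2" for x
      proof -
        have "\<bar>x\<bar> < r" using that r(1) by linarith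
        then show ?thesis using r(2)[of x] by auto
      qed
    qed (use r e pi_gt3 in auto)
  qed
  have c\<sigma>: "c x = \<sigma> (\<rho> x)" if "\<bar>x\<bar> < e'" for x
    unfolding \<rho>_def using c[of x] near[OF that] that e' d
    by (intro uniq) (auto simp: has_gauss_angle_def meridian_plane_0 \<rho>_def)
  have a\<rho>: "a (\<rho> x) = sin x" if "\<bar>x\<bar> < e'" for x
    using N\<sigma>[of "\<rho> x"] c[of x] near[OF that] c\<sigma>[OF that] that e' d
    by (auto simp: has_gauss_angle_def)
  have sc: "sin x > 0" "cos x > 0" if "0 < x" "x < e'" for x
    using that e' by (auto intro!: sin_gt_zero cos_gt_zero)
  have \<rho>_ne: "\<rho> x \<noteq> 0" if "0 < x" "x < e'" for x
    using a\<rho>[of x] sc[OF that] a0 that by auto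
  have r1: "r1 S N p x = \<rho> x / sin x" if x: "0 < x" "x < e'" for x
    using k1[of "\<rho> x"] \<rho>_ne[OF x] near[of x] d a\<rho>[of x] c\<sigma>[of x] x
    by (simp add: r1_def radius_parallel_def flip: c_def)
  have r2: "r2 S N p x = 1 / a' (\<rho> x)" if x: "0 < x" "x < e'" for x
    using k2[of "\<rho> x"] near[of x] d c\<sigma>[of x] x
    by (simp add: r2_def radius_profile_def flip: c_def)
  \<comment> \<open>\<open>\<rho>\<close> is known to be continuous only. Since
    \<open>arcsin (a (\<rho> y)) = y\<close>, the inverse function rule makes it differentiable,
    with derivative \<open>cos x / a' (\<rho> x)\<close>.\<close>
  have d\<rho>: "(\<rho> has_real_derivative r2 S N p x * cos x) (at x)" if x: "0 < x" "x < e'" for x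
  proof -
    have a': "(a has_real_derivative a' (\<rho> x)) (at (\<rho> x))" "a' (\<rho> x) \<noteq> 0"
      using near[of x] x d by (auto intro!: da a'_ne)
    have ax: "a (\<rho> x) = sin x" using a\<rho>[of x] x by simp
    have cx: "cos x > 0" using sc x by simp
    have sq: "sqrt (1 - (sin x)\<^sup>2) = cos x"
      using cx by (simp flip: cos_squared_eq)
    have "(sin x)\<^sup>2 < 1" using cx by (simp add: sin_squared_eq)
    then have lt: "-1 < sin x" "sin x < 1" by (auto simp: power2_less_1_iff abs_less_iff abs_square_less_1)
    have "((\<lambda>t. arcsin (a t)) has_real_derivative inverse (cos x) * a' (\<rho> x)) (at (\<rho> x))"
      using DERIV_chain2[OF DERIV_arcsin a'(1)] lt by (simp add: ax sq)
    then have "(\<rho> has_real_derivative inverse (inverse (cos x) * a' (\<rho> x))) (at x)"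
    proof (rule DERIV_inverse_function[where a = "-e'" and b = e'])
      show "arcsin (a (\<rho> y)) = y" if "-e' < y" "y < e'" for y
        using that e' a\<rho>[of y] by (simp add: arcsin_sin abs_less_iff)
    qed (use x e' a' cx cont\<rho> in auto)
    then show ?thesis using r2[OF x] by (simp add: field_simps)
  qed
  show "\<forall>\<^sub>F x in at_right 0. (r1 S N p has_real_derivative
            (r2 S N p x - r1 S N p x) * cos x / sin x) (at x)"
    unfolding eventually_at_right_field
  proof (intro exI[of _ e'] conjI allI impI e')
    fix x assume x: "0 < x" "x < e'"
    have D: "((\<lambda>x. \<rho> x / sin x) has_real_derivative (r2 S N p x - r1 S N p x) * cos x / sin x) (at x)"
      using sc[OF x] by (auto intro!: derivative_eq_intros d\<rho> x simp: r1[OF x] field_simps power2_eq_square)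
    have ev: "\<forall>\<^sub>F y in nhds x. \<rho> y / sin y = r1 S N p y"
      using eventually_nhds_in_open[of "{0<..<e'}" x] x r1 by (auto elim!: eventually_mono)
    show "(r1 S N p has_real_derivative (r2 S N p x - r1 S N p x) * cos x / sin x) (at x)"
      using D by (rule DERIV_cong_ev[OF refl ev refl, THEN iffD1])
  qed
  have interval: "\<forall>\<^sub>F x in at_right 0. 0 < x \<and> x < e'"
    unfolding eventually_at_right_field using e' by auto
  have c_lim: "(c \<longlongrightarrow> p) (at_right 0)"
    using contc'[of 0] e c0 by (auto simp: isCont_def intro: filterlim_at_split[THEN iffD1, THEN conjunct2])
  show "(r1 S N p \<longlongrightarrow> radius_parallel S N p) (at_right 0)"
  proof -
    have "(\<rho> \<longlongrightarrow> 0) (at_right 0)"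
      using tendsto_vec_nth[OF c_lim, of 2] axis by (simp add: \<rho>_def[abs_def] on_axis_def)
    then have "filterlim \<rho> (at 0) (at_right 0)"
      unfolding filterlim_at using interval \<rho>_ne by (auto elim: eventually_mono)
    \<comment> \<open>As \<open>a 0 = 0\<close>, this is the difference quotient of \<open>a\<close>
      at 0. Its limit \<open>a' 0\<close> is the parallel curvature at \<open>p\<close>.\<close>
    moreover have "((\<lambda>t. a t / t) \<longlongrightarrow> a' 0) (at 0)"
      using da[of 0] \<delta> by (simp add: has_field_derivative_iff a0)
    ultimately have "((\<lambda>x. a (\<rho> x) / \<rho> x) \<longlongrightarrow> a' 0) (at_right 0)"
      by (rule filterlim_compose[rotated])
    then have "((\<lambda>x. 1 / (a (\<rho> x) / \<rho> x)) \<longlongrightarrow> 1 / a' 0) (at_right 0)"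
      by (intro tendsto_intros a'0)
    then have "(r1 S N p \<longlongrightarrow> 1 / a' 0) (at_right 0)"
      by (rule Lim_transform_eventually) (use interval in eventually_elim, use a\<rho> r1 in auto)
    then show ?thesis using k1[of 0] \<delta> \<sigma>0 by (simp add: radius_parallel_def)
  qed
  show "\<forall>\<^sub>F x in at_right 0. r1 S N p x \<noteq> r2 S N p x"
  proof -
    obtain W where W: "open W" "p \<in> W" "\<And>q. q \<in> S \<inter> W \<Longrightarrow> umbilic S N q \<Longrightarrow> q = p"
      using iso unfolding isolated_umbilic_def openin_open by blast
    have "\<forall>\<^sub>F x in at_right 0. c x \<in> W"
      using c_lim W by (simp add: topological_tendstoD)
    with interval show ?thesis
    proof eventually_elim
      case (elim x)
      \<comment> \<open>The point has left the axis, so isolation of \<open>p\<close> prevents it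
        from being umbilic.\<close>
      have "c x \<noteq> p" using \<rho>_ne[of x] elim axis by (auto simp: \<rho>_def on_axis_def)
      then have "\<not> umbilic S N (c x)" using W(3)[of "c x"] c[of x] elim e' by auto
      then show ?case
        using c[of x] elim e' by (auto simp: umbilic_def r1_def r2_def simp flip: c_def)
    qed
  qed
qed

theorem theorem3p8:
  fixes S :: "(real^3) set" and N :: "real^3 \<Rightarrow> real^3" and p :: "real^3" and \<mu> :: real
  assumes "C2_surface_of_revolution S N"
    and "isolated_umbilic S N p"
    and "on_axis p"
    and "has_gauss_angle N p 0"
    and "strictly_convex_at S N p"
    and "has_umbilic_slope S N p \<mu>"
  shows "(\<forall>\<alpha> \<gamma> :: real. \<alpha> \<ge> 0 \<longrightarrow>
            ((\<lambda>\<theta>. (r2 S N p \<theta> - r1 S N p \<theta>) / (sin \<theta> powr \<alpha>)) \<longlongrightarrow> \<gamma>) (at_right 0) \<longrightarrow>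
            \<mu> \<ge> \<alpha> + 1 \<and> (\<gamma> \<noteq> 0 \<longrightarrow> \<mu> = \<alpha> + 1))
       \<and> (\<forall>\<alpha> :: real. \<alpha> \<ge> 0 \<longrightarrow> \<mu> > \<alpha> + 1 \<longrightarrow>
            ((\<lambda>\<theta>. (r2 S N p \<theta> - r1 S N p \<theta>) / (sin \<theta> powr \<alpha>)) \<longlongrightarrow> 0) (at_right 0))"
proof -
  note radii = DERIV_r1[OF assms(1-5)] r1_tendsto[OF assms(1-5)] r1_neq_r2[OF assms(1-5)]
    assms(6)[unfolded has_umbilic_slope_def]
  have B: "((\<lambda>\<theta>. (r2 S N p \<theta> - r1 S N p \<theta>) / (sin \<theta> powr \<alpha>)) \<longlongrightarrow> 0) (at_right 0)"
    if "\<alpha> \<ge> 0" "\<mu> > \<alpha> + 1" for \<alpha>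
    using radii_difference_tendsto_0[OF radii that] .
  have A: "\<mu> \<ge> \<alpha> + 1 \<and> (\<gamma> \<noteq> 0 \<longrightarrow> \<mu> = \<alpha> + 1)"
    if \<alpha>: "\<alpha> \<ge> 0" and \<gamma>: "((\<lambda>\<theta>. (r2 S N p \<theta> - r1 S N p \<theta>) / (sin \<theta> powr \<alpha>)) \<longlongrightarrow> \<gamma>) (at_right 0)" for \<alpha> \<gamma>
  proof -
    have le: "\<mu> \<ge> \<alpha> + 1" using slope_lower_bound[OF radii \<alpha> \<gamma>] .
    \<comment> \<open>A strict inequality is the hypothesis of (B), so both \<open>\<gamma>\<close>
      and 0 are limits of the same quotient.\<close>
    moreover have "\<gamma> = 0" if "\<mu> > \<alpha> + 1"
      using tendsto_unique[OF trivial_limit_at_right_real \<gamma> B[OF \<alpha> that]] .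
    ultimately show ?thesis by fastforce
  qed
  show ?thesis using A B by blast
qed

end
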